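(* Let $f$, $P_1$, $P_2$, $P=P_1-P_2$, $F=f+P$ and $L>0$ satisfy the standing assumptions given in the context (in particular $F$ is level-bounded). Let $\mathcal{X}$ be the set of stationary points of $F$, and suppose that $P_2$ is continuously differentiable on an open set $\mathcal{N}_0$ containing $\mathcal{X}$ and that $\nabla P_2$ is locally Lipschitz continuous on $\mathcal{N}_0$. Let $\{x^t\}$ be a sequence generated by ${\rm pDCA}_e$ (defined in the context) for solving $\min_{x\in\mathbb{R}^n}F(x)$, and suppose that $\{x^t\}$ converges to some $\bar x$. Suppose further that the function $$E(x,y)=f(x)+P(x)+\frac{L}{2}\|x-y\|^2,\qquad (x,y)\in\mathbb{R}^n\times\mathbb{R}^n,$$ is a KL function for which the function $\phi$ in the KL inequality takes the form $\phi(s)=cs^{1-\theta}$ for some $\theta\in[0,1)$ and $c>0$ (that is, $E$ satisfies the KL property at every point of $\mathrm{dom}\,\partial E$ with such a $\phi$). Then the following statements hold. (i) If $\theta=0$, then there exists $t_0>0$ so that $x^t$ is constant for $t>t_0$. (ii) If $\theta\in(0,\frac12]$, then there exist $c_1>0$, $t_1>0$ and $\eta\in(0,1)$ such that $\|x^t-\bar x\|<c_1\eta^t$ for $t>t_1$. (iii) If $\theta\in(\frac12,1)$, then there exist $c_2>0$ and $t_2>0$ such that $\|x^t-\bar x\|<c_2\,t^{-\frac{1-\theta}{2\theta-1}}$ for $t>t_2$.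
   Context: Notation: $\mathbb{R}^n$ carries the inner product $\langle\cdot,\cdot\rangle$ and Euclidean norm $\|\cdot\|$. For an extended-real-valued function $h$, $\mathrm{dom}\,h=\{x: h(x)<\infty\}$; $h$ is proper if it never equals $-\infty$ and $\mathrm{dom}\,h\neq\emptyset$; a proper function is closed if it is lower semicontinuous; a proper closed $h$ is level-bounded if $\{x: h(x)\le r\}$ is bounded for every $r\in\mathbb{R}$. $\mathrm{dist}(x,C)=\inf_{y\in C}\|x-y\|$ (equal to $+\infty$ if $C=\emptyset$). Subdifferential: for a proper closed $h$ and $x\in\mathrm{dom}\,h$, $\partial h(x)$ is the limiting subdifferential, i.e. the set of $v$ for which there exist $x^k\to x$ with $h(x^k)\to h(x)$ and $v^k\to v$ such that $\liminf_{y\to x^k,\,y\ne x^k}\frac{h(y)-h(x^k)-\langle v^k,y-x^k\rangle}{\|y-x^k\|}\ge 0$ for each $k$. For convex $h$ it equals $\{v: h(u)-h(x)-\langle v,u-x\rangle\ge0\ \forall u\}$. $\mathrm{dom}\,\partial h=\{x:\partial h(x)\neq\emptyset\}$. KL property: a proper closed function $h$ satisfies the KL property at $\hat x\in\mathrm{dom}\,\partial h$ if there exist $a\in(0,\infty]$, a neighborhood $\mathcal{O}$ of $\hat x$ and a continuous concave function $\phi:[0,a)\to[0,\infty)$ with $\phi(0)=0$ such that $\phi$ is continuously differentiable on $(0,a)$ with $\phi'>0$, and the KL inequality $\phi'(h(x)-h(\hat x))\,\mathrm{dist}(0,\partial h(x))\ge 1$ holds for every $x\in\mathcal{O}$ with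 $h(\hat x)<h(x)<h(\hat x)+a$. A proper closed function satisfying the KL property at all points of $\mathrm{dom}\,\partial h$ is called a KL function. When $\phi$ is required to have the form $\phi(s)=cs^{1-\theta}$, the numbers $\theta$ and $c$ are fixed, while $a$ and $\mathcal{O}$ may depend on the point $\hat x$. Standing assumptions: $F(x)=f(x)+P(x)$ with $P(x)=P_1(x)-P_2(x)$, where $f:\mathbb{R}^n\to\mathbb{R}$ is a smooth convex function whose gradient is Lipschitz continuous with modulus $L>0$, $P_1:\mathbb{R}^n\to(-\infty,\infty]$ is proper closed convex, $P_2:\mathbb{R}^n\to\mathbb{R}$ is a continuous convex function, and $F$ is level-bounded. Algorithm ${\rm pDCA}_e$ (proximal difference-of-convex algorithm with extrapolation): the input is $x^0\in\mathrm{dom}\,P_1$ and $\{\beta_t\}\subseteq[0,1)$ with $\sup_t\beta_t<1$. Set $x^{-1}=x^0$. For $t=0,1,2,\dots$, take any $\xi^t\in\partial P_2(x^t)$ and set $$y^t=x^t+\beta_t(x^t-x^{t-1}),\qquad x^{t+1}=\operatorname{arg\,min}_{y\in\mathbb{R}^n}\Big\{\langle\nabla f(y^t)-\xi^t,y\rangle+\tfrac{L}{2}\|y-y^t\|^2+P_1(y)\Big\}.$$ Stationary point: $\bar x$ is a stationary point of $F$ if $0\in\nabla f(\bar x)+\partial P_1(\bar x)-\partial P_2(\bar x)$ (Minkowski sum and difference of sets); $\mathcal{X}$ denotes the set of all stationary points of $F$. *)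

theory Defs
  imports "HOL-Analysis.Analysis"
begin

definition edom :: "('a \<Rightarrow> ereal) \<Rightarrow> 'a set"
  where "edom h = {x. h x < \<infinity>}"

definition proper_fun :: "('a \<Rightarrow> ereal) \<Rightarrow> bool"
  where "proper_fun h \<longleftrightarrow> (\<forall>x. h x \<noteq> -\<infinity>) \<and> edom h \<noteq> {}"

definition lower_semicontinuous :: "('a::topological_space \<Rightarrow> ereal) \<Rightarrow> bool"
  where "lower_semicontinuous h \<longleftrightarrow> (\<forall>x. h x \<le> Liminf (at x) h)"

definition level_bounded :: "('a::metric_space \<Rightarrow> ereal) \<Rightarrow> bool"
  where "level_bounded h \<longleftrightarrow> (\<forall>r::real. bounded {x. h x \<le> ereal r})"

text \<open>Meant for functions that never take the value \<open>-\<infinity>\<close>, so that the right-hand side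
  contains no \<open>\<infinity> - \<infinity>\<close>.\<close>

definition convex_fun :: "('a::real_vector \<Rightarrow> ereal) \<Rightarrow> bool"
  where "convex_fun h \<longleftrightarrow>
    (\<forall>x y. \<forall>s::real. 0 < s \<and> s < 1 \<longrightarrow>
       h ((1 - s) *\<^sub>R x + s *\<^sub>R y) \<le> ereal (1 - s) * h x + ereal s * h y)"

text \<open>The library's \<open>infdist\<close> and \<open>setdist\<close> are \<open>0\<close> on the empty set; here the infimum
  is taken in \<open>ereal\<close>, so the distance to the empty set is \<open>\<infinity>\<close>.\<close>

definition edist_set :: "'a::real_normed_vector \<Rightarrow> 'a set \<Rightarrow> ereal"
  where "edist_set x C = (INF y\<in>C. ereal (norm (x - y)))"

text \<open>Both subdifferentials are empty outside the domain, which in particular keeps the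
  difference quotient free of \<open>\<infinity> - \<infinity>\<close> when \<open>h\<close> is proper.\<close>

definition regular_subdifferential :: "('a::real_inner \<Rightarrow> ereal) \<Rightarrow> 'a \<Rightarrow> 'a set"
  where "regular_subdifferential h x =
    {v. x \<in> edom h \<and>
        0 \<le> Liminf (at x) (\<lambda>y. (h y - h x - ereal (v \<bullet> (y - x))) / ereal (norm (y - x)))}"

definition subdifferential :: "('a::real_inner \<Rightarrow> ereal) \<Rightarrow> 'a \<Rightarrow> 'a set"
  where "subdifferential h x =
    {v. x \<in> edom h \<and>
        (\<exists>xs vs. xs \<longlonglongrightarrow> x \<and> (\<lambda>k. h (xs k)) \<longlonglongrightarrow> h x \<and> vs \<longlonglongrightarrow> v \<and>
                 (\<forall>k::nat. vs k \<in> regular_subdifferential h (xs k)))}"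

definition dom_subdifferential :: "('a::real_inner \<Rightarrow> ereal) \<Rightarrow> 'a set"
  where "dom_subdifferential h = {x. subdifferential h x \<noteq> {}}"

definition desingularizing :: "ereal \<Rightarrow> (real \<Rightarrow> real) \<Rightarrow> bool"
  where "desingularizing a \<phi> \<longleftrightarrow>
    (let I = {s. 0 \<le> s \<and> ereal s < a}; J = {s. 0 < s \<and> ereal s < a} in
      (\<forall>s\<in>I. 0 \<le> \<phi> s) \<and> \<phi> 0 = 0 \<and> continuous_on I \<phi> \<and> concave_on I \<phi> \<and>
      \<phi> C1_differentiable_on J \<and> (\<forall>s\<in>J. 0 < deriv \<phi> s))"

text \<open>The KL property at a point for a given \<open>\<phi>\<close>; only the range \<open>a\<close> and the neighbourhood
  may depend on the point.\<close>

definition KL_property_with ::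
    "(real \<Rightarrow> real) \<Rightarrow> ('a::real_inner \<Rightarrow> ereal) \<Rightarrow> 'a \<Rightarrow> bool"
  where "KL_property_with \<phi> h z \<longleftrightarrow>
    (\<exists>a U. 0 < a \<and> open U \<and> z \<in> U \<and> desingularizing a \<phi> \<and>
       (\<forall>x\<in>U. h z < h x \<and> h x < h z + a \<longrightarrow>
          1 \<le> ereal (deriv \<phi> (real_of_ereal (h x - h z))) * edist_set 0 (subdifferential h x)))"

definition KL_function_with :: "(real \<Rightarrow> real) \<Rightarrow> ('a::real_inner \<Rightarrow> ereal) \<Rightarrow> bool"
  where "KL_function_with \<phi> h \<longleftrightarrow>
    proper_fun h \<and> lower_semicontinuous h \<and>
    (\<forall>z \<in> dom_subdifferential h. KL_property_with \<phi> h z)"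

definition dc_objective ::
    "('a \<Rightarrow> real) \<Rightarrow> ('a \<Rightarrow> ereal) \<Rightarrow> ('a \<Rightarrow> real) \<Rightarrow> 'a \<Rightarrow> ereal"
  where "dc_objective f P1 P2 x = ereal (f x) + (P1 x - ereal (P2 x))"

definition auxiliary_fun ::
    "real \<Rightarrow> ('a::real_normed_vector \<Rightarrow> real) \<Rightarrow> ('a \<Rightarrow> ereal) \<Rightarrow> ('a \<Rightarrow> real) \<Rightarrow> 'a \<times> 'a \<Rightarrow> ereal"
  where "auxiliary_fun L f P1 P2 =
    (\<lambda>(x, y). dc_objective f P1 P2 x + ereal (L / 2 * (norm (x - y))\<^sup>2))"

text \<open>In the next two definitions \<open>gradf\<close> is the gradient of the smooth part \<open>f\<close>.\<close>

definition stationary_points ::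
    "('a::real_inner \<Rightarrow> 'a) \<Rightarrow> ('a \<Rightarrow> ereal) \<Rightarrow> ('a \<Rightarrow> real) \<Rightarrow> 'a set"
  where "stationary_points gradf P1 P2 =
    {x. 0 \<in> {gradf x + u - w | u w.
               u \<in> subdifferential P1 x \<and> w \<in> subdifferential (\<lambda>z. ereal (P2 z)) x}}"

text \<open>Truncated subtraction on \<open>nat\<close> gives \<open>x (0 - 1) = x 0\<close>, which is the convention
  \<open>x\<^sup>-\<^sup>1 = x\<^sup>0\<close>. The subproblem is strongly convex for \<open>L > 0\<close>, so its minimizer is unique.\<close>

definition pDCAe ::
    "real \<Rightarrow> ('a::real_inner \<Rightarrow> 'a) \<Rightarrow> ('a \<Rightarrow> ereal) \<Rightarrow> ('a \<Rightarrow> real) \<Rightarrow>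
     (nat \<Rightarrow> real) \<Rightarrow> (nat \<Rightarrow> 'a) \<Rightarrow> (nat \<Rightarrow> 'a) \<Rightarrow> bool"
  where "pDCAe L gradf P1 P2 \<beta> \<xi> x \<longleftrightarrow>
    x 0 \<in> edom P1 \<and>
    (\<forall>t. 0 \<le> \<beta> t \<and> \<beta> t < 1) \<and> (SUP t. \<beta> t) < 1 \<and>
    (\<forall>t. \<xi> t \<in> subdifferential (\<lambda>z. ereal (P2 z)) (x t) \<and>
       (let y = x t + \<beta> t *\<^sub>R (x t - x (t - 1)) in
          is_arg_min
            (\<lambda>z. ereal ((gradf y - \<xi> t) \<bullet> z + L / 2 * (norm (z - y))\<^sup>2) + P1 z)
            (\<lambda>_. True) (x (Suc t))))"

definition locally_lipschitz_on ::
    "'a::metric_space set \<Rightarrow> ('a \<Rightarrow> 'b::metric_space) \<Rightarrow> bool"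
  where "locally_lipschitz_on S g \<longleftrightarrow>
    (\<forall>x\<in>S. \<exists>r>0. \<exists>K. K-lipschitz_on (ball x r \<inter> S) g)"

end

theory Submission
  imports Defs
begin

text \<open>
  Write \<open>E t\<close> for the value of the auxiliary function at \<open>(x (t + 1), x t)\<close> and
  \<open>d t\<close> for \<open>norm (x (t + 1) - x t)\<close>. Convexity and the optimality condition of the
  subproblem give \<open>E (t + 1) + D (d t)\<^sup>2 \<le> E t\<close> with \<open>D > 0\<close>, so \<open>E\<close> decreases to its value
  \<open>E\<^sub>\<infinity>\<close> at \<open>(xbar, xbar)\<close>. The limit is stationary, hence lies in \<open>N0\<close>; there the
  Lipschitz gradient of \<open>P2\<close> yields an explicit subgradient of the auxiliary function of norm
  \<open>O(d (t + 1) + d t)\<close>. With \<open>r t = E t - E\<^sub>\<infinity>\<close>, the KL inequality becomes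
  \<open>r (t + 1) powr \<theta> \<le> C (d (t + 1) + d t)\<close>. Concavity of \<open>s powr (1 - \<theta>)\<close> then bounds the tail
  of \<open>\<Sum> d t\<close> by \<open>r t powr (1 - \<theta>) + sqrt (r t)\<close>, while squaring gives the recurrence
  \<open>r (t + 2) powr (2 \<theta>) \<le> M (r t - r (t + 2))\<close>, which determines the rate of \<open>r\<close>.
\<close>

subsection \<open>Subdifferentials and gradients\<close>

text \<open>The quotient of \<open>h\<close> dominates that of \<open>k\<close>, which tends to 0 by
  differentiability. Explicit subgradients below are all produced by such a differentiable
  minorant.\<close>

lemma regular_subdifferential_touching:
  fixes h :: "'a::real_inner \<Rightarrow> ereal" and k :: "'a \<Rightarrow> real"
  assumes below: "\<And>z. ereal (k z) \<le> h z" and touch: "h x = ereal (k x)"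
    and deriv: "(k has_derivative (\<lambda>d. v \<bullet> d)) (at x)"
  shows "v \<in> regular_subdifferential h x"
proof -
  let ?q = "\<lambda>y. (k y - k x - v \<bullet> (y - x)) / norm (y - x)"
  have lim: "(?q \<longlongrightarrow> 0) (at x)"
  proof (rule tendsto_norm_zero_cancel)
    show "((\<lambda>y. norm (?q y)) \<longlongrightarrow> 0) (at x)"
      using deriv by (simp add: has_derivative_iff_norm norm_divide)
  qed
  have "ereal 0 \<le> Liminf (at x) (\<lambda>y. (h y - h x - ereal (v \<bullet> (y - x))) / ereal (norm (y - x)))"
  proof (cases "at x = (bot :: 'a filter)")
    \<comment> \<open>In a zero-dimensional space \<open>x\<close> is isolated, and
      \<open>Liminf\<close> over the trivial filter is the top element.\<close>
    case True
    then show ?thesis by (simp add: Liminf_bot)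
  next
    case False
    have "ereal 0 = Liminf (at x) (\<lambda>y. ereal (?q y))"
      using lim_imp_Liminf[OF False tendsto_ereal[OF lim]] by simp
    also have "\<dots> \<le> Liminf (at x) (\<lambda>y. (h y - h x - ereal (v \<bullet> (y - x))) / ereal (norm (y - x)))"
    proof (intro Liminf_mono, unfold eventually_at_filter, intro always_eventually allI impI)
      fix y assume "y \<noteq> x"
      then have pos: "norm (y - x) > 0" by simp
      show "ereal (?q y) \<le> (h y - h x - ereal (v \<bullet> (y - x))) / ereal (norm (y - x))"
      proof (cases "h y")
        case (real r)
        then show ?thesis using below[of y] touch pos by (simp add: divide_right_mono)
      next
        case PInf
        then show ?thesis using touch pos by (simp add: ereal_divide)
      next
        case MInf
        then show ?thesis using below[of y] by simp
      qed
    qed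
    finally show ?thesis .
  qed
  then show ?thesis
    using touch by (simp add: regular_subdifferential_def edom_def zero_ereal_def)
qed

lemma regular_subdifferential_subset: "regular_subdifferential h x \<subseteq> subdifferential h x"
proof
  fix v assume v: "v \<in> regular_subdifferential h x"
  then have "x \<in> edom h" by (simp add: regular_subdifferential_def)
  moreover have "(\<lambda>_::nat. x) \<longlonglongrightarrow> x \<and> (\<lambda>_::nat. h x) \<longlonglongrightarrow> h x \<and> (\<lambda>_::nat. v) \<longlonglongrightarrow> v \<and>
      (\<forall>k::nat. v \<in> regular_subdifferential h x)"
    using v by simp
  ultimately show "v \<in> subdifferential h x"
    unfolding subdifferential_def
    by (intro CollectI conjI exI[of _ "\<lambda>_::nat. x"] exI[of _ "\<lambda>_::nat. v"]) auto
qed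

section \<open>Convex functions and their gradients\<close>

lemma subgradient_in_subdifferential:
  fixes h :: "'a::real_inner \<Rightarrow> ereal"
  assumes "\<And>u. h x + ereal (v \<bullet> (u - x)) \<le> h u" "h x = ereal p"
  shows "v \<in> subdifferential h x"
proof -
  have "v \<in> regular_subdifferential h x"
  proof (rule regular_subdifferential_touching[where k = "\<lambda>u. p + v \<bullet> (u - x)"])
    show "((\<lambda>u. p + v \<bullet> (u - x)) has_derivative (\<bullet>) v) (at x)"
      by (auto intro!: derivative_eq_intros)
  qed (use assms in auto)
  then show ?thesis using regular_subdifferential_subset by blast
qed

text \<open>If the inequality failed at \<open>u\<close>, convexity would keep the difference
  quotient along the segment towards \<open>u\<close> at or below a fixed negative number
  arbitrarily close to \<open>x\<close>.\<close>

lemma regular_subdifferential_convex: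
  fixes g :: "'a::real_inner \<Rightarrow> real"
  assumes cvx: "convex_on UNIV g" and v: "v \<in> regular_subdifferential (\<lambda>z. ereal (g z)) x"
  shows "g x + v \<bullet> (u - x) \<le> g u"
proof (rule ccontr)
  assume neg: "\<not> ?thesis"
  then have ux: "u \<noteq> x" by auto
  define \<delta> where "\<delta> = (g u - g x - v \<bullet> (u - x)) / norm (u - x)"
  have \<delta>: "\<delta> < 0" using neg ux by (simp add: \<delta>_def divide_neg_pos)
  have "ereal \<delta> < Liminf (at x) (\<lambda>y. (ereal (g y) - ereal (g x) - ereal (v \<bullet> (y - x))) / ereal (norm (y - x)))"
    using v \<delta> by (auto simp: regular_subdifferential_def zero_ereal_def
        intro: less_le_trans[of _ "ereal 0"])
  then have "eventually (\<lambda>y. ereal \<delta> < (ereal (g y) - ereal (g x) - ereal (v \<bullet> (y - x))) / ereal (norm (y - x))) (at x)"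
    by (rule less_LiminfD)
  then have "eventually (\<lambda>y. y \<noteq> x \<longrightarrow> \<delta> < (g y - g x - v \<bullet> (y - x)) / norm (y - x)) (at x)"
    by eventually_elim (simp split: if_splits)
  then obtain e where e: "e > 0"
    "\<And>y. y \<noteq> x \<Longrightarrow> dist y x < e \<Longrightarrow> \<delta> < (g y - g x - v \<bullet> (y - x)) / norm (y - x)"
    unfolding eventually_at by auto
  \<comment> \<open>The cap 1 keeps \<open>?y\<close> on the segment; the other entry keeps it
    within \<open>e\<close> of \<open>x\<close>.\<close>
  define s where "s = min 1 (e / (2 * norm (u - x)))"
  have s: "0 < s" "s \<le> 1" using e(1) ux by (auto simp: s_def)
  have sle: "s * norm (u - x) \<le> e / 2"
    using ux by (auto simp: s_def min_def field_simps)
  let ?y = "x + s *\<^sub>R (u - x)"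
  have "\<delta> < (g ?y - g x - v \<bullet> (?y - x)) / norm (?y - x)"
    using e s sle ux by (intro e(2)) (auto simp: dist_norm)
  also have "\<dots> = (g ?y - g x - s * (v \<bullet> (u - x))) / (s * norm (u - x))"
    using s by simp
  also have "\<dots> \<le> (s * (g u - g x - v \<bullet> (u - x))) / (s * norm (u - x))"
  proof (rule divide_right_mono)
    have "g ((1 - s) *\<^sub>R x + s *\<^sub>R u) \<le> (1 - s) * g x + s * g u"
      using s by (intro convex_onD[OF cvx]) auto
    moreover have "(1 - s) *\<^sub>R x + s *\<^sub>R u = ?y" by (simp add: algebra_simps)
    ultimately show "g ?y - g x - s * (v \<bullet> (u - x)) \<le> s * (g u - g x - v \<bullet> (u - x))"
      by (simp add: algebra_simps)
  qed (use s in auto)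
  also have "\<dots> = \<delta>" using s by (simp add: \<delta>_def)
  finally show False by simp
qed

text \<open>The inequality for regular subgradients survives the limits that define limiting
  ones.\<close>

lemma subdifferential_convex:
  fixes g :: "'a::real_inner \<Rightarrow> real"
  assumes cvx: "convex_on UNIV g" and v: "v \<in> subdifferential (\<lambda>z. ereal (g z)) x"
  shows "g x + v \<bullet> (u - x) \<le> g u"
proof -
  obtain xs vs where lims: "xs \<longlonglongrightarrow> x" "(\<lambda>k. g (xs k)) \<longlonglongrightarrow> g x" "vs \<longlonglongrightarrow> v"
    and reg: "\<And>k::nat. vs k \<in> regular_subdifferential (\<lambda>z. ereal (g z)) (xs k)"
    using v unfolding subdifferential_def by auto
  have "(\<lambda>k. g (xs k) + vs k \<bullet> (u - xs k)) \<longlonglongrightarrow> g x + v \<bullet> (u - x)"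
    by (intro tendsto_intros lims)
  then show ?thesis
    by (rule LIMSEQ_le_const2) (use regular_subdifferential_convex[OF cvx reg] in auto)
qed

lemma gderiv_inner: "GDERIV g x :> w \<longleftrightarrow> (g has_derivative (\<lambda>d. w \<bullet> d)) (at x)"
  by (simp add: gderiv_def inner_commute)

text \<open>A differentiable function touches itself from below, so its gradient is a regular
  subgradient.\<close>

lemma convex_gradient_ineq:
  fixes g :: "'a::real_inner \<Rightarrow> real"
  assumes "convex_on UNIV g" "GDERIV g x :> w"
  shows "g x + w \<bullet> (u - x) \<le> g u"
  using assms by (intro regular_subdifferential_convex regular_subdifferential_touching[where k = g])
    (auto simp: gderiv_inner)

text \<open>Subtracting the affine minorant leaves a function minimal at \<open>x\<close>, so its
  derivative vanishes there. This later identifies \<open>\<xi> t\<close> with the gradient of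
  \<open>P2\<close>.\<close>

lemma subgradient_eq_gradient:
  fixes g :: "'a::real_inner \<Rightarrow> real"
  assumes sub: "\<And>u. g x + v \<bullet> (u - x) \<le> g u" and grad: "GDERIV g x :> w"
  shows "v = w"
proof -
  have "((\<lambda>u. g u - v \<bullet> (u - x)) has_derivative (\<lambda>d. w \<bullet> d - v \<bullet> d)) (at x)"
    using grad unfolding gderiv_inner by (auto intro!: derivative_eq_intros)
  then have "(\<lambda>d. w \<bullet> d - v \<bullet> d) = (\<lambda>d. 0)"
    by (rule has_derivative_local_min) (use sub in \<open>auto simp: algebra_simps\<close>)
  then have "w \<bullet> (w - v) - v \<bullet> (w - v) = 0" by meson
  then have "(w - v) \<bullet> (w - v) = 0" by (simp add: inner_diff_left)
  then show ?thesis by simp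
qed

section \<open>Descent lemma and proximal subproblem\<close>

lemma lipschitz_gradient_upper_bound:
  fixes f :: "'a::real_inner \<Rightarrow> real"
  assumes grad: "\<And>z. GDERIV f z :> gradf z" and lip: "L-lipschitz_on UNIV gradf"
  shows "f z \<le> f y + gradf y \<bullet> (z - y) + L / 2 * (norm (z - y))\<^sup>2"
proof -
  \<comment> \<open>The claim is \<open>?g 1 \<le> ?g 0\<close>; the slope is nonpositive since the
    gradient drifts by at most \<open>L * s * norm (z - y)\<close>.\<close>
  let ?g = "\<lambda>s. f (y + s *\<^sub>R (z - y)) - s * (gradf y \<bullet> (z - y)) - L / 2 * s\<^sup>2 * (norm (z - y))\<^sup>2"
  let ?g' = "\<lambda>s. gradf (y + s *\<^sub>R (z - y)) \<bullet> (z - y) - gradf y \<bullet> (z - y) - L * s * (norm (z - y))\<^sup>2"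
  have "?g 1 \<le> ?g 0"
  proof (rule DERIV_nonpos_imp_nonincreasing[of 0 1 ?g])
    fix s :: real assume s: "0 \<le> s" "s \<le> 1"
    have "((\<lambda>s. f (y + s *\<^sub>R (z - y))) has_derivative
        (\<lambda>d. gradf (y + s *\<^sub>R (z - y)) \<bullet> (d *\<^sub>R (z - y)))) (at s)"
    proof (rule has_derivative_compose[where g = f and f = "\<lambda>s. y + s *\<^sub>R (z - y)"])
      show "((\<lambda>s. y + s *\<^sub>R (z - y)) has_derivative (\<lambda>d. d *\<^sub>R (z - y))) (at s)"
        by (auto intro!: derivative_eq_intros)
    qed (use grad gderiv_inner in blast)
    then have "((\<lambda>s. f (y + s *\<^sub>R (z - y))) has_real_derivative
        gradf (y + s *\<^sub>R (z - y)) \<bullet> (z - y)) (at s)"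
      by (simp add: has_field_derivative_def mult.commute[of _ "_ \<bullet> _"])
    then have "(?g has_real_derivative ?g' s) (at s)"
      by (auto intro!: derivative_eq_intros)
    moreover have "?g' s \<le> 0"
    proof -
      have "(gradf (y + s *\<^sub>R (z - y)) - gradf y) \<bullet> (z - y)
          \<le> norm (gradf (y + s *\<^sub>R (z - y)) - gradf y) * norm (z - y)"
        by (rule norm_cauchy_schwarz)
      also have "\<dots> \<le> (L * norm (s *\<^sub>R (z - y))) * norm (z - y)"
        using lipschitz_onD[OF lip, of "y + s *\<^sub>R (z - y)" y]
        by (intro mult_right_mono) (auto simp: dist_norm)
      also have "\<dots> = L * s * (norm (z - y))\<^sup>2" using s by (simp add: power2_eq_square)
      finally show ?thesis by (simp add: inner_diff_left)
    qed
    ultimately show "\<exists>D. (?g has_real_derivative D) (at s) \<and> D \<le> 0" by blast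
  qed simp
  then show ?thesis by simp
qed

text \<open>Comparing \<open>p\<close> with points on the segment towards \<open>u\<close> and
  letting the step tend to 0 removes the quadratic term, which leaves a subgradient inequality for
  \<open>P\<close> at \<open>p\<close>.\<close>

lemma prox_optimality:
  fixes P :: "'a::real_inner \<Rightarrow> ereal"
  assumes proper: "proper_fun P" and cvx: "convex_fun P"
    and min: "is_arg_min (\<lambda>z. ereal (a \<bullet> z + L / 2 * (norm (z - y))\<^sup>2) + P z) (\<lambda>_. True) p"
  shows "p \<in> edom P" "P p + ereal (- (a + L *\<^sub>R (p - y)) \<bullet> (u - p)) \<le> P u"
proof -
  let ?q = "\<lambda>z. a \<bullet> z + L / 2 * (norm (z - y))\<^sup>2"
  have le: "ereal (?q p) + P p \<le> ereal (?q z) + P z" for z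
    using min unfolding is_arg_min_def by (auto simp: not_less)
  have noMInf: "P z \<noteq> -\<infinity>" for z using proper by (simp add: proper_fun_def)
  obtain z0 where "P z0 < \<infinity>" using proper by (auto simp: proper_fun_def edom_def)
  then show dom: "p \<in> edom P"
    using le[of z0] by (cases "P z0"; cases "P p") (auto simp: edom_def)
  then obtain p0 where p0: "P p = ereal p0"
    using noMInf[of p] by (cases "P p") (auto simp: edom_def)
  show "P p + ereal (- (a + L *\<^sub>R (p - y)) \<bullet> (u - p)) \<le> P u"
  proof (cases "P u")
    case (real u0)
    have "0 \<le> (a + L *\<^sub>R (p - y)) \<bullet> (u - p) + (u0 - p0) + s * (L / 2 * (norm (u - p))\<^sup>2)"
      if s: "0 < s" "s < 1" for s
    proof -
      let ?z = "(1 - s) *\<^sub>R p + s *\<^sub>R u"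
      have "ereal (?q p) + P p \<le> ereal (?q ?z) + P ?z" by (rule le)
      also have "\<dots> \<le> ereal (?q ?z) + (ereal (1 - s) * P p + ereal s * P u)"
        using cvx s by (intro add_left_mono) (auto simp: convex_fun_def)
      finally have 1: "?q p + p0 \<le> ?q ?z + ((1 - s) * p0 + s * u0)"
        using p0 real by simp
      have zeq: "?z - y = (p - y) + s *\<^sub>R (u - p)" "?z = p + s *\<^sub>R (u - p)"
        by (auto simp: algebra_simps)
      have 2: "?q ?z = ?q p + s * ((a + L *\<^sub>R (p - y)) \<bullet> (u - p)) + s * s * (L / 2 * (norm (u - p))\<^sup>2)"
        unfolding zeq(1) power2_norm_eq_inner
        by (subst zeq(2)) (simp add: inner_add_left inner_add_right inner_commute algebra_simps)
      \<comment> \<open>One factor \<open>s\<close> cancels; the quadratic term keeps a second one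
        and vanishes as \<open>s\<close> tends to 0 from the right.\<close>
      have "0 \<le> s * ((a + L *\<^sub>R (p - y)) \<bullet> (u - p) + (u0 - p0) + s * (L / 2 * (norm (u - p))\<^sup>2))"
        using 1 unfolding 2 by (simp add: algebra_simps)
      then show ?thesis using s by (simp add: zero_le_mult_iff)
    qed
    then have "eventually (\<lambda>s. 0 \<le> (a + L *\<^sub>R (p - y)) \<bullet> (u - p) + (u0 - p0) + s * (L / 2 * (norm (u - p))\<^sup>2))
        (at_right 0)"
      unfolding eventually_at_right_field by (intro exI[of _ 1]) auto
    moreover have "((\<lambda>s. (a + L *\<^sub>R (p - y)) \<bullet> (u - p) + (u0 - p0) + s * (L / 2 * (norm (u - p))\<^sup>2))
        \<longlongrightarrow> (a + L *\<^sub>R (p - y)) \<bullet> (u - p) + (u0 - p0) + 0 * (L / 2 * (norm (u - p))\<^sup>2)) (at_right 0)"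
      by (intro tendsto_intros)
    ultimately have "0 \<le> (a + L *\<^sub>R (p - y)) \<bullet> (u - p) + (u0 - p0)"
      using tendsto_lowerbound[of _ _ "at_right (0::real)" 0] by fastforce
    then show ?thesis using p0 real by (simp add: inner_diff_left inner_add_left)
  qed (use noMInf in auto)
qed

text \<open>A unit step from \<open>x t\<close> in the direction of \<open>\<xi> t\<close> raises
  the affine minorant by \<open>norm (\<xi> t)\<close>, while \<open>g\<close> varies boundedly on a
  compact ball.\<close>

lemma subgradients_bounded:
  fixes g :: "'a::euclidean_space \<Rightarrow> real"
  assumes cont: "continuous_on UNIV g" and bdd: "bounded (range x)"
    and sub: "\<And>(t::nat) u. g (x t) + \<xi> t \<bullet> (u - x t) \<le> g u"
  shows "bounded (range \<xi>)"
proof -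
  obtain R where R: "\<And>t. norm (x t) \<le> R" using bdd by (auto simp: bounded_iff)
  have "compact (g ` cball 0 (R + 1))"
    by (intro compact_continuous_image continuous_on_subset[OF cont]) auto
  then obtain B where B: "\<And>u. norm u \<le> R + 1 \<Longrightarrow> \<bar>g u\<bar> \<le> B"
    by (auto dest!: compact_imp_bounded simp: bounded_iff dist_norm) (metis mem_cball_0)
  have "norm (\<xi> t) \<le> 2 * B" for t
  proof (cases "\<xi> t = 0")
    case False
    define u where "u = x t + (1 / norm (\<xi> t)) *\<^sub>R \<xi> t"
    have "norm (\<xi> t) = \<xi> t \<bullet> (u - x t)"
      using False by (simp add: u_def dot_square_norm power2_eq_square)
    also have "\<dots> \<le> g u - g (x t)" using sub[of t u] by simp
    also have "\<dots> \<le> 2 * B"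
    proof -
      have "norm u \<le> R + 1"
        using norm_triangle_ineq[of "x t" "(1 / norm (\<xi> t)) *\<^sub>R \<xi> t"] R[of t] False
        by (simp add: u_def)
      then show ?thesis using B[of u] B[of "x t"] R[of t] by linarith
    qed
    finally show ?thesis .
  next
    case True
    then show ?thesis using B[of "x t"] R[of t] by simp
  qed
  then show ?thesis by (auto simp: bounded_iff)
qed

text \<open>Replacing \<open>P1\<close> by its affine minorant turns the auxiliary function into a
  minorant that touches it at \<open>(x, y)\<close> and is differentiable there; the pair is its
  gradient.\<close>

lemma auxiliary_fun_subgradient:
  fixes f P2 :: "'a::real_inner \<Rightarrow> real"
  assumes p: "P1 x = ereal p" and v: "\<And>u. P1 x + ereal (v \<bullet> (u - x)) \<le> P1 u"
    and f: "GDERIV f x :> gf" and P2: "GDERIV P2 x :> g2"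
  shows "(gf + v - g2 + L *\<^sub>R (x - y), - (L *\<^sub>R (x - y)))
    \<in> subdifferential (auxiliary_fun L f P1 P2) (x, y)"
proof -
  let ?k = "\<lambda>z. f (fst z) + (p + v \<bullet> (fst z - x)) - P2 (fst z)
    + L / 2 * ((fst z - snd z) \<bullet> (fst z - snd z))"
  have "(gf + v - g2 + L *\<^sub>R (x - y), - (L *\<^sub>R (x - y)))
      \<in> regular_subdifferential (auxiliary_fun L f P1 P2) (x, y)"
  proof (rule regular_subdifferential_touching[where k = ?k])
    fix z :: "'a \<times> 'a"
    have "ereal (p + v \<bullet> (fst z - x)) \<le> P1 (fst z)" using v[of "fst z"] p by simp
    then show "ereal (?k z) \<le> auxiliary_fun L f P1 P2 z"
      by (cases "P1 (fst z)")
        (auto simp: auxiliary_fun_def dc_objective_def case_prod_beta power2_norm_eq_inner)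
  next
    show "auxiliary_fun L f P1 P2 (x, y) = ereal (?k (x, y))"
      by (simp add: auxiliary_fun_def dc_objective_def p power2_norm_eq_inner)
  next
    have fst: "((\<lambda>z::'a \<times> 'a. g (fst z)) has_derivative (\<lambda>d. w \<bullet> fst d)) (at (x, y))"
      if "GDERIV g x :> w" for g w
      using that unfolding gderiv_inner
      by (intro has_derivative_compose[where f = fst and g = g]) (auto intro!: derivative_eq_intros)
    show "(?k has_derivative (\<bullet>) (gf + v - g2 + L *\<^sub>R (x - y), - (L *\<^sub>R (x - y)))) (at (x, y))"
      by (rule derivative_eq_intros fst[OF f] fst[OF P2] refl)+
        (simp add: fun_eq_iff inner_add_left inner_diff_left inner_diff_right inner_commute algebra_simps)
  qed
  then show ?thesis using regular_subdifferential_subset by blast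
qed

text \<open>\<open>lower_semicontinuous\<close> speaks of the punctured filter;
  \<open>C < h l\<close> covers the indices with \<open>x t = l\<close>.\<close>

lemma lower_semicontinuous_eventually:
  fixes h :: "'a::t1_space \<Rightarrow> ereal"
  assumes lsc: "lower_semicontinuous h" and lim: "(x \<longlongrightarrow> l) F" and less: "C < h l"
  shows "\<forall>\<^sub>F t in F. C < h (x t)"
proof -
  have "C < Liminf (at l) h"
    using lsc less unfolding lower_semicontinuous_def by (meson less_le_trans)
  then have "\<forall>\<^sub>F u in at l. C < h u" by (rule less_LiminfD)
  then have "\<forall>\<^sub>F u in nhds l. C < h u"
    unfolding eventually_at_filter by eventually_elim (use less in auto)
  then show ?thesis using lim by (rule eventually_compose_filterlim)
qed

subsection \<open>Rates from a KL recurrence\<close>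

text \<open>By the mean value theorem: the derivative of \<open>s powr (1 - \<theta>)\<close> is
  nonincreasing, so at an intermediate point it is at least its value at \<open>s\<close>.\<close>

lemma powr_concave_diff:
  fixes s u \<theta> :: real
  assumes "0 < u" "u \<le> s" "0 \<le> \<theta>" "\<theta> < 1"
  shows "(1 - \<theta>) * s powr (- \<theta>) * (s - u) \<le> s powr (1 - \<theta>) - u powr (1 - \<theta>)"
proof (cases "u = s")
  case False
  then have us: "u < s" using assms by simp
  obtain z where z: "u < z" "z < s"
    "s powr (1 - \<theta>) - u powr (1 - \<theta>) = (s - u) * ((1 - \<theta>) * z powr (- \<theta>))"
  proof -
    have "\<exists>z. u < z \<and> z < s \<and>
        s powr (1 - \<theta>) - u powr (1 - \<theta>) = (s - u) * ((1 - \<theta>) * z powr (- \<theta>))"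
      by (rule MVT2[OF us]) (use assms in \<open>auto intro!: derivative_eq_intros\<close>)
    then show ?thesis using that by blast
  qed
  have "s powr (- \<theta>) \<le> z powr (- \<theta>)"
    using z assms by (intro powr_mono2') auto
  then have "(s - u) * ((1 - \<theta>) * s powr (- \<theta>)) \<le> (s - u) * ((1 - \<theta>) * z powr (- \<theta>))"
    using us assms by (intro mult_left_mono) auto
  then show ?thesis using z(3) by (simp add: mult_ac)
qed simp

text \<open>AM-GM for \<open>b\<close> and \<open>e / 4\<close>.\<close>

lemma le_of_square_le_prod:
  fixes a b e :: real
  assumes "a\<^sup>2 \<le> b * e" "0 \<le> b" "0 \<le> e"
  shows "a \<le> b + e / 4"
proof (rule power2_le_imp_le)
  have "(b + e / 4)\<^sup>2 - b * e = (b - e / 4)\<^sup>2" by (simp add: power2_eq_square algebra_simps)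
  then show "a\<^sup>2 \<le> (b + e / 4)\<^sup>2" using assms(1) zero_le_power2[of "b - e / 4"] by linarith
qed (use assms in simp)

section \<open>Tail bound and value recurrence\<close>

text \<open>Descent, concavity and KL bound the squared step by the drop of
  \<open>r powr (1 - \<theta>)\<close> times the sum of two consecutive steps. AM-GM makes this
  linear in the steps, and summation bounds the distance to the limit.\<close>

lemma kl_tail_bound:
  fixes x :: "nat \<Rightarrow> 'a::real_normed_vector"
  assumes pos: "D > 0" "C > 0" "0 \<le> \<theta>" "\<theta> < 1"
    and r: "\<And>t. 0 < r t"
    and desc: "\<And>t. r (Suc t) + D * (norm (x (Suc t) - x t))\<^sup>2 \<le> r t"
    and kl: "\<And>t. r (Suc t) powr \<theta> \<le> C * (norm (x (Suc (Suc t)) - x (Suc t)) + norm (x (Suc t) - x t))"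
    and lim: "x \<longlonglongrightarrow> xbar"
  obtains A where "A \<ge> 0" "\<And>t. norm (x (Suc t) - xbar) \<le> A * (r t powr (1 - \<theta>) + sqrt (r t))"
proof -
  define d where "d t = norm (x (Suc t) - x t)" for t
  define K where "K = C / ((1 - \<theta>) * D)"
  define W where "W t = K * r (Suc t) powr (1 - \<theta>) + d t / 4" for t
  have K: "K > 0" using pos by (simp add: K_def)
  have d0: "d t \<ge> 0" for t by (simp add: d_def)
  have desc': "r (Suc t) + D * (d t)\<^sup>2 \<le> r t" for t using desc by (simp add: d_def)
  have mono: "r (Suc t) \<le> r t" for t
    using desc'[of t] pos(1) zero_le_mult_iff[of D "(d t)\<^sup>2"] zero_le_power2[of "d t"] by linarith
  \<comment> \<open>The summand \<open>d t / 4\<close> of \<open>W\<close> absorbs the term \<open>d t\<close> left over by AM-GM, so that the bound telescopes.\<close>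
  have step: "d (Suc t) \<le> 2 * (W t - W (Suc t))" for t
  proof -
    let ?r = "r (Suc t)" and ?\<delta> = "r (Suc t) powr (1 - \<theta>) - r (Suc (Suc t)) powr (1 - \<theta>)"
    let ?e = "d (Suc t) + d t"
    have klt: "?r powr \<theta> \<le> C * ?e" using kl by (simp add: d_def)
    have \<delta>0: "?\<delta> \<ge> 0" using powr_mono2[of "1 - \<theta>" "r (Suc (Suc t))" ?r] mono r pos
      by (simp add: less_imp_le)
    have "(1 - \<theta>) * ?r powr (- \<theta>) * (D * (d (Suc t))\<^sup>2)
        \<le> (1 - \<theta>) * ?r powr (- \<theta>) * (?r - r (Suc (Suc t)))"
      using desc'[of "Suc t"] pos by (intro mult_left_mono) auto
    also have "\<dots> \<le> ?\<delta>" using powr_concave_diff[OF r mono pos(3,4)] .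
    \<comment> \<open>The factor \<open>?r powr \<theta>\<close> cancels the negative power on the
      left and is bounded by KL on the right.\<close>
    finally have "?r powr \<theta> * ((1 - \<theta>) * ?r powr (- \<theta>) * (D * (d (Suc t))\<^sup>2)) \<le> ?r powr \<theta> * ?\<delta>"
      by (intro mult_left_mono) auto
    also have "\<dots> \<le> C * ?e * ?\<delta>" using klt \<delta>0 by (intro mult_right_mono)
    finally have "(?r powr \<theta> * ?r powr (- \<theta>)) * ((1 - \<theta>) * D * (d (Suc t))\<^sup>2) \<le> C * ?e * ?\<delta>"
      by (simp only: mult_ac)
    moreover have "?r powr \<theta> * ?r powr (- \<theta>) = 1"
      using r[of "Suc t"] by (simp flip: powr_add)
    ultimately have "(1 - \<theta>) * D * (d (Suc t))\<^sup>2 \<le> C * ?e * ?\<delta>" by simp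
    then have "(d (Suc t))\<^sup>2 \<le> (K * ?\<delta>) * ?e"
      using pos by (simp add: K_def field_simps)
    then have "d (Suc t) \<le> K * ?\<delta> + ?e / 4"
      using K \<delta>0 d0 by (intro le_of_square_le_prod) (auto intro: add_nonneg_nonneg)
    then show ?thesis unfolding W_def right_diff_distrib by argo
  qed
  have W0: "W t \<ge> 0" for t using K d0 by (simp add: W_def)
  have tele: "norm (x (n + Suc t) - x (Suc t)) \<le> 2 * (W t - W (n + t))" for n t
  proof (induction n)
    case (Suc n)
    have "norm (x (Suc n + Suc t) - x (Suc t)) \<le> d (Suc (n + t)) + norm (x (n + Suc t) - x (Suc t))"
      unfolding d_def using norm_triangle_ineq[of "x (Suc n + Suc t) - x (n + Suc t)" "x (n + Suc t) - x (Suc t)"]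
      by simp
    then show ?case using step[of "n + t"] Suc by simp
  qed simp
  have tail: "norm (xbar - x (Suc t)) \<le> 2 * W t" for t
  proof (rule LIMSEQ_le_const2)
    show "(\<lambda>n. norm (x (n + Suc t) - x (Suc t))) \<longlonglongrightarrow> norm (xbar - x (Suc t))"
      by (intro tendsto_intros LIMSEQ_ignore_initial_segment lim)
    \<comment> \<open>Dropping \<open>W (n + t) \<ge> 0\<close> makes the bound independent of
      \<open>n\<close>, so it passes to the limit.\<close>
    have "norm (x (n + Suc t) - x (Suc t)) \<le> 2 * W t" for n
      using tele[of n t] W0[of "n + t"] by simp
    then show "\<exists>N. \<forall>n\<ge>N. norm (x (n + Suc t) - x (Suc t)) \<le> 2 * W t" by blast
  qed
  show ?thesis
  \<comment> \<open>\<open>2 * K\<close> serves the power part of \<open>2 * W t\<close>; the rest,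
    \<open>d t / 2\<close>, is at most \<open>sqrt (r t / D)\<close> by descent.\<close>
  proof (rule that[of "2 * K + 1 / sqrt D"])
    show "0 \<le> 2 * K + 1 / sqrt D" using K pos by simp
    fix t
    have "(d t)\<^sup>2 \<le> r t / D" using desc'[of t] r[of "Suc t"] pos(1) by (simp add: field_simps)
    then have "d t \<le> sqrt (r t / D)" by (rule real_le_rsqrt)
    then have dt: "d t \<le> 1 / sqrt D * sqrt (r t)" by (simp add: real_sqrt_divide)
    have "K * r (Suc t) powr (1 - \<theta>) \<le> K * r t powr (1 - \<theta>)"
      using K pos r[of "Suc t"] mono[of t] by (intro mult_left_mono powr_mono2) auto
    then have "2 * W t \<le> 2 * K * r t powr (1 - \<theta>) + 1 / sqrt D * sqrt (r t)"
      using dt d0[of t] by (simp add: W_def)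
    also have "\<dots> \<le> (2 * K + 1 / sqrt D) * (r t powr (1 - \<theta>) + sqrt (r t))"
      using K pos r[of t] by (simp add: algebra_simps)
    finally show "norm (x (Suc t) - xbar) \<le> (2 * K + 1 / sqrt D) * (r t powr (1 - \<theta>) + sqrt (r t))"
      using tail[of t] by (simp add: norm_minus_commute)
  qed
qed

text \<open>KL involves two consecutive steps, so squaring it and adding two descent inequalities
  gives a drop over two indices.\<close>

lemma kl_value_recurrence:
  fixes d r :: "nat \<Rightarrow> real"
  assumes pos: "D > 0" "C > 0" "0 \<le> \<theta>"
    and r: "\<And>t. 0 < r t"
    and desc: "\<And>t. r (Suc t) + D * (d t)\<^sup>2 \<le> r t"
    and kl: "\<And>t. r (Suc t) powr \<theta> \<le> C * (d (Suc t) + d t)"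
  shows "r (Suc (Suc t)) powr (2 * \<theta>) \<le> 2 * C\<^sup>2 / D * (r t - r (Suc (Suc t)))"
proof -
  have mono: "r (Suc t) \<le> r t" for t
    using desc[of t] pos(1) zero_le_mult_iff[of D "(d t)\<^sup>2"] zero_le_power2[of "d t"] by linarith
  have "r (Suc (Suc t)) powr (2 * \<theta>) \<le> r (Suc t) powr (2 * \<theta>)"
    using pos r[of "Suc (Suc t)"] mono[of "Suc t"] by (intro powr_mono2) auto
  also have "\<dots> = (r (Suc t) powr \<theta>)\<^sup>2" by (simp add: power2_eq_square flip: powr_add)
  also have "\<dots> \<le> (C * (d (Suc t) + d t))\<^sup>2" using kl by (intro power_mono) auto
  also have "\<dots> = C\<^sup>2 * (d (Suc t) + d t)\<^sup>2" by (simp add: power_mult_distrib)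
  also have "\<dots> \<le> C\<^sup>2 * (2 * ((d (Suc t))\<^sup>2 + (d t)\<^sup>2))"
    using zero_le_power2[of "d (Suc t) - d t"]
    by (intro mult_left_mono) (auto simp: power2_eq_square algebra_simps)
  also have "\<dots> = 2 * C\<^sup>2 / D * (D * (d (Suc t))\<^sup>2 + D * (d t)\<^sup>2)" using pos by (simp add: field_simps)
  also have "\<dots> \<le> 2 * C\<^sup>2 / D * (r t - r (Suc (Suc t)))"
    using desc[of t] desc[of "Suc t"] pos by (intro mult_left_mono) auto
  finally show ?thesis .
qed

section \<open>Decay of two-step recurrences\<close>

lemma two_step_geometric:
  fixes r :: "nat \<Rightarrow> real"
  assumes \<eta>: "0 < \<eta>" and step: "\<And>t. r (Suc (Suc t)) \<le> \<eta>\<^sup>2 * r t"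
  obtains B where "B > 0" "\<And>t. r t \<le> B * \<eta> ^ t"
proof -
  \<comment> \<open>The recurrence runs separately on even and odd indices, so \<open>B\<close> must
    cover both starting values; 1 makes it positive.\<close>
  define B where "B = max 1 (max (r 0) (r (Suc 0) / \<eta>))"
  have "r t \<le> B * \<eta> ^ t" for t
  proof (induction t rule: induct_nat_012)
    case 1
    have "r (Suc 0) / \<eta> \<le> B" by (simp add: B_def)
    then show ?case using \<eta> by (simp add: field_simps)
  next
    case (ge2 t)
    have "r (Suc (Suc t)) \<le> \<eta>\<^sup>2 * (B * \<eta> ^ t)"
      using step[of t] mult_left_mono[OF ge2(1), of "\<eta>\<^sup>2"] by simp
    then show ?case by (simp add: power2_eq_square mult_ac)
  qed (simp add: B_def)
  moreover have "B > 0" by (simp add: B_def)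
  ultimately show ?thesis using that by blast
qed

text \<open>The mean value theorem gives a point beyond \<open>k\<close>, and
  \<open>(k + 2) / 3 \<le> k\<close> trades it for \<open>k + 2\<close> at the price of the power of
  3.\<close>

lemma powr_two_step_diff:
  fixes p k :: real
  assumes "p > 0" "k \<ge> 1"
  shows "k powr (- p) - (k + 2) powr (- p) \<le> 2 * p * 3 powr (p + 1) * (k + 2) powr (- p - 1)"
proof -
  have "\<exists>z. k < z \<and> z < k + 2 \<and>
      (k + 2) powr (- p) - k powr (- p) = (k + 2 - k) * (- p * z powr (- p - 1))"
    by (rule MVT2) (use assms in \<open>auto intro!: derivative_eq_intros\<close>)
  then obtain z where z: "k < z" "k powr (- p) - (k + 2) powr (- p) = 2 * p * z powr (- p - 1)"
    by (auto simp: algebra_simps)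
  have "z powr (- p - 1) \<le> ((k + 2) / 3) powr (- p - 1)"
    using z assms by (intro powr_mono2') auto
  also have "\<dots> = 3 powr (p + 1) * (k + 2) powr (- p - 1)"
  proof -
    have "((k + 2) / 3) powr (- p - 1) = (k + 2) powr (- p - 1) / 3 powr (- p - 1)"
      using assms by (simp add: powr_divide)
    moreover have "3 powr (- p - 1) = 1 / 3 powr (p + 1)"
      using powr_minus_divide[of 3 "p + 1"] by simp
    ultimately show ?thesis by simp
  qed
  finally show ?thesis using z assms mult_left_mono[of _ _ "2 * p"] by (simp add: mult.assoc)
qed

text \<open>With \<open>p = 1 / (q - 1)\<close> one has \<open>p * q = p + 1\<close>, so the
  \<open>q\<close>-th power of \<open>k powr (- p)\<close> and its two-step decrement have the same
  order; a large \<open>B\<close> then propagates the bound. The index \<open>Suc t\<close> avoids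
  \<open>0 powr a = 0\<close> at \<open>t = 0\<close>.\<close>

lemma two_step_sublinear:
  fixes r :: "nat \<Rightarrow> real"
  assumes q: "q > 1" and M: "M > 0" and r: "\<And>t. 0 < r t"
    and step: "\<And>t. r (Suc (Suc t)) powr q \<le> M * (r t - r (Suc (Suc t)))"
  obtains B where "B > 0" "\<And>t. r t \<le> B * real (Suc t) powr (- (1 / (q - 1)))"
proof -
  define p where "p = 1 / (q - 1)"
  have p: "p > 0" "p * q = p + 1" using q by (auto simp: p_def field_simps)
  define G where "G = M * (2 * p * 3 powr (p + 1))"
  \<comment> \<open>\<open>G powr p\<close> ensures \<open>B powr (q - 1) \<ge> G\<close>; the other
    entries settle the two base cases.\<close>
  define B where "B = max (G powr p) (max (r 0) (r (Suc 0) * 2 powr p))"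
  have G: "G > 0" using M p by (simp add: G_def)
  have B: "B > 0" using G by (auto simp: B_def less_max_iff_disj)
  have BG: "B powr q \<ge> G * B"
  proof -
    have "G = (G powr p) powr (q - 1)" using G q by (simp add: p_def powr_powr)
    also have "\<dots> \<le> B powr (q - 1)" using q by (intro powr_mono2) (auto simp: B_def)
    finally have "G * B \<le> B powr (q - 1) * B powr 1" using B by (simp add: mult_right_mono)
    also have "\<dots> = B powr q" by (subst powr_add[symmetric]) simp
    finally show ?thesis .
  qed
  have "r t \<le> B * real (Suc t) powr (- p)" for t
  proof (induction t rule: induct_nat_012)
    case 1
    have "r (Suc 0) * 2 powr p \<le> B" by (simp add: B_def)
    then show ?case by (simp add: powr_minus field_simps)
  next
    case (ge2 t)
    let ?k = "real (Suc t)"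
    show ?case
    proof (rule ccontr)
      \<comment> \<open>Failure at \<open>t + 2\<close> enlarges the left side of the recurrence and
        shrinks its right side.\<close>
      assume "\<not> ?thesis"
      then have big: "B * (?k + 2) powr (- p) < r (Suc (Suc t))" by (simp add: add.commute)
      have "G * B * (?k + 2) powr (- p - 1) \<le> B powr q * (?k + 2) powr (- p - 1)"
        using BG by (intro mult_right_mono) auto
      also have "\<dots> = (B * (?k + 2) powr (- p)) powr q"
      proof -
        have "(- p) * q = - p - 1" using p(2) by simp
        then show ?thesis using B by (simp add: powr_mult powr_powr)
      qed
      also have "\<dots> \<le> r (Suc (Suc t)) powr q" using big B q by (intro powr_mono2) auto
      also have "\<dots> \<le> M * (r t - r (Suc (Suc t)))" by (rule step)
      also have "\<dots> < M * (B * ?k powr (- p) - B * (?k + 2) powr (- p))"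
        using ge2(1) big M by (intro mult_strict_left_mono) auto
      also have "\<dots> = M * B * (?k powr (- p) - (?k + 2) powr (- p))" by (simp add: algebra_simps)
      also have "\<dots> \<le> M * B * (2 * p * 3 powr (p + 1) * (?k + 2) powr (- p - 1))"
        using M B p by (intro mult_left_mono powr_two_step_diff) auto
      also have "\<dots> = G * B * (?k + 2) powr (- p - 1)" by (simp add: G_def mult_ac)
      finally show False by simp
    qed
  qed (simp add: B_def)
  then show ?thesis using that B by (simp add: p_def)
qed

section \<open>Rates for the iterates\<close>

text \<open>As \<open>r t \<le> 1\<close> and \<open>2 * \<theta> \<le> 1\<close>, the value is at
  most its power \<open>2 * \<theta>\<close>, so the recurrence is a contraction; in the tail bound
  the square root dominates.\<close>

lemma kl_linear_rate:
  fixes x :: "nat \<Rightarrow> 'a::real_normed_vector"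
  assumes pos: "D > 0" "C > 0" "0 \<le> \<theta>" "\<theta> \<le> 1 / 2"
    and r: "\<And>t. 0 < r t" "\<And>t. r t \<le> 1"
    and desc: "\<And>t. r (Suc t) + D * (norm (x (Suc t) - x t))\<^sup>2 \<le> r t"
    and kl: "\<And>t. r (Suc t) powr \<theta> \<le> C * (norm (x (Suc (Suc t)) - x (Suc t)) + norm (x (Suc t) - x t))"
    and lim: "x \<longlonglongrightarrow> xbar"
  obtains B \<eta> where "B > 0" "0 < \<eta>" "\<eta> < 1" "\<And>t. norm (x (Suc t) - xbar) \<le> B * \<eta> ^ t"
proof -
  define M where "M = 2 * C\<^sup>2 / D"
  \<comment> \<open>Solving \<open>u \<le> M * (w - u)\<close> for \<open>u\<close> gives this
    ratio.\<close>
  define \<rho> where "\<rho> = M / (1 + M)"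
  have M: "M > 0" using pos by (simp add: M_def)
  have \<rho>: "0 < \<rho>" "\<rho> < 1" using M by (auto simp: \<rho>_def)
  have step: "r (Suc (Suc t)) \<le> (sqrt \<rho>)\<^sup>2 * r t" for t
  proof -
    have "r (Suc (Suc t)) \<le> r (Suc (Suc t)) powr (2 * \<theta>)"
      using powr_mono'[of "2 * \<theta>" 1 "r (Suc (Suc t))"] r[of "Suc (Suc t)"] pos by simp
    also have "\<dots> \<le> M * (r t - r (Suc (Suc t)))"
      unfolding M_def by (rule kl_value_recurrence[where d = "\<lambda>t. norm (x (Suc t) - x t)", OF pos(1-3) r(1) desc kl])
    finally show ?thesis using M \<rho> by (simp add: \<rho>_def field_simps)
  qed
  obtain B where B: "B > 0" "\<And>t. r t \<le> B * sqrt \<rho> ^ t"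
    using two_step_geometric[of "sqrt \<rho>" r] step \<rho> by auto
  have "\<theta> < 1" using pos by simp
  obtain A where A: "A \<ge> 0" "\<And>t. norm (x (Suc t) - xbar) \<le> A * (r t powr (1 - \<theta>) + sqrt (r t))"
    using kl_tail_bound[OF pos(1-3) \<open>\<theta> < 1\<close> r(1) desc kl lim] by blast
  show ?thesis
  \<comment> \<open>One root since a contraction takes two steps, another since the tail is of order
    \<open>sqrt (r t)\<close>; the summand 1 keeps the constant positive if
    \<open>A = 0\<close>.\<close>
  proof (rule that[of "2 * A * sqrt B + 1" "sqrt (sqrt \<rho>)"])
    show "0 < 2 * A * sqrt B + 1" using A B by (simp add: add_nonneg_pos)
    show "0 < sqrt (sqrt \<rho>)" "sqrt (sqrt \<rho>) < 1" using \<rho> by auto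
    fix t
    have "r t powr (1 - \<theta>) \<le> r t powr (1 / 2)"
      using r[of t] pos by (intro powr_mono') auto
    then have "r t powr (1 - \<theta>) + sqrt (r t) \<le> 2 * sqrt (r t)" using r[of t] by (simp add: powr_half_sqrt)
    moreover have "sqrt (r t) \<le> sqrt B * sqrt (sqrt \<rho>) ^ t"
      using B(2)[of t] by (simp flip: real_sqrt_mult real_sqrt_power)
    ultimately have "r t powr (1 - \<theta>) + sqrt (r t) \<le> 2 * (sqrt B * sqrt (sqrt \<rho>) ^ t)" by linarith
    then have "norm (x (Suc t) - xbar) \<le> A * (2 * (sqrt B * sqrt (sqrt \<rho>) ^ t))"
      using A(2)[of t] mult_left_mono[OF _ A(1)] by (meson order_trans)
    also have "\<dots> \<le> (2 * A * sqrt B + 1) * sqrt (sqrt \<rho>) ^ t" using \<rho> by (simp add: algebra_simps)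
    finally show "norm (x (Suc t) - xbar) \<le> (2 * A * sqrt B + 1) * sqrt (sqrt \<rho>) ^ t" .
  qed
qed

text \<open>Now \<open>1 - \<theta> < 1 / 2\<close>, so the power dominates the square root in the
  tail bound. The exponent is \<open>1 / (2 * \<theta> - 1)\<close>, from the recurrence, times
  \<open>1 - \<theta>\<close>.\<close>

lemma kl_sublinear_rate:
  fixes x :: "nat \<Rightarrow> 'a::real_normed_vector"
  assumes pos: "D > 0" "C > 0" "1 / 2 < \<theta>" "\<theta> < 1"
    and r: "\<And>t. 0 < r t" "\<And>t. r t \<le> 1"
    and desc: "\<And>t. r (Suc t) + D * (norm (x (Suc t) - x t))\<^sup>2 \<le> r t"
    and kl: "\<And>t. r (Suc t) powr \<theta> \<le> C * (norm (x (Suc (Suc t)) - x (Suc t)) + norm (x (Suc t) - x t))"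
    and lim: "x \<longlonglongrightarrow> xbar"
  obtains B where "B > 0"
    "\<And>t. norm (x (Suc t) - xbar) \<le> B * real (Suc t) powr (- ((1 - \<theta>) / (2 * \<theta> - 1)))"
proof -
  define M where "M = 2 * C\<^sup>2 / D"
  have M: "M > 0" using pos by (simp add: M_def)
  have \<theta>0: "0 \<le> \<theta>" using pos by simp
  have step: "r (Suc (Suc t)) powr (2 * \<theta>) \<le> M * (r t - r (Suc (Suc t)))" for t
    unfolding M_def by (rule kl_value_recurrence[where d = "\<lambda>t. norm (x (Suc t) - x t)", OF pos(1,2) \<theta>0 r(1) desc kl])
  have "2 * \<theta> > 1" using pos by simp
  then obtain B where B: "B > 0" "\<And>t. r t \<le> B * real (Suc t) powr (- (1 / (2 * \<theta> - 1)))"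
    using two_step_sublinear[where r = r, OF _ M r(1) step] by blast
  obtain A where A: "A \<ge> 0" "\<And>t. norm (x (Suc t) - xbar) \<le> A * (r t powr (1 - \<theta>) + sqrt (r t))"
    using kl_tail_bound[OF pos(1,2) \<theta>0 pos(4) r(1) desc kl lim] by blast
  let ?e = "- ((1 - \<theta>) / (2 * \<theta> - 1))"
  show ?thesis
  proof (rule that[of "2 * A * B powr (1 - \<theta>) + 1"])
    show "0 < 2 * A * B powr (1 - \<theta>) + 1" using A B by (simp add: add_nonneg_pos)
    fix t
    have "r t powr (1 / 2) \<le> r t powr (1 - \<theta>)"
      using r[of t] pos by (intro powr_mono') auto
    then have "r t powr (1 - \<theta>) + sqrt (r t) \<le> 2 * r t powr (1 - \<theta>)" using r[of t] by (simp add: powr_half_sqrt)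
    moreover have "r t powr (1 - \<theta>) \<le> B powr (1 - \<theta>) * real (Suc t) powr ?e"
    proof -
      have "r t powr (1 - \<theta>) \<le> (B * real (Suc t) powr (- (1 / (2 * \<theta> - 1)))) powr (1 - \<theta>)"
        using B(2)[of t] r[of t] pos by (intro powr_mono2) auto
      also have "\<dots> = B powr (1 - \<theta>) * real (Suc t) powr ?e"
        using B(1) by (simp add: powr_mult powr_powr)
      finally show ?thesis .
    qed
    ultimately have "r t powr (1 - \<theta>) + sqrt (r t) \<le> 2 * (B powr (1 - \<theta>) * real (Suc t) powr ?e)" by linarith
    then have "norm (x (Suc t) - xbar) \<le> A * (2 * (B powr (1 - \<theta>) * real (Suc t) powr ?e))"
      using A(2)[of t] mult_left_mono[OF _ A(1)] by (meson order_trans)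
    also have "\<dots> \<le> (2 * A * B powr (1 - \<theta>) + 1) * real (Suc t) powr ?e" by (simp add: algebra_simps)
    finally show "norm (x (Suc t) - xbar) \<le> (2 * A * B powr (1 - \<theta>) + 1) * real (Suc t) powr ?e" .
  qed
qed

text \<open>Either \<open>r\<close> reaches 0, and descent freezes the iterates from there on, or KL
  holds at all late indices and the rate lemmas apply to a shifted sequence.\<close>

lemma kl_convergence_rates:
  fixes x :: "nat \<Rightarrow> 'a::real_normed_vector" and r :: "nat \<Rightarrow> real"
  assumes pos: "D > 0" "C > 0" "0 \<le> \<theta>" "\<theta> < 1"
    and r: "\<And>t. 0 \<le> r t" "r \<longlonglongrightarrow> 0"
    and desc: "\<And>t. r (Suc t) + D * (norm (x (Suc t) - x t))\<^sup>2 \<le> r t"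
    and kl: "\<forall>\<^sub>F t in sequentially. 0 < r (Suc t) \<longrightarrow>
      r (Suc t) powr \<theta> \<le> C * (norm (x (Suc (Suc t)) - x (Suc t)) + norm (x (Suc t) - x t))"
    and lim: "x \<longlonglongrightarrow> xbar"
  shows "(\<theta> = 0 \<longrightarrow> (\<exists>t0>0. x constant_on {t0<..})) \<and>
    (0 < \<theta> \<and> \<theta> \<le> 1 / 2 \<longrightarrow>
       (\<exists>c1>0. \<exists>t1>0. \<exists>\<eta>. 0 < \<eta> \<and> \<eta> < 1 \<and>
          (\<forall>t>t1. norm (x t - xbar) < c1 * \<eta> ^ t))) \<and>
    (1 / 2 < \<theta> \<and> \<theta> < 1 \<longrightarrow>
       (\<exists>c2>0. \<exists>t2>0. \<forall>t>t2.
          norm (x t - xbar) < c2 * real t powr (- ((1 - \<theta>) / (2 * \<theta> - 1)))))"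
proof (cases "\<exists>T. r T = 0")
  case True
  then obtain T where T: "r T = 0" by blast
  have "r (n + T) = 0 \<and> x (n + T) = x T" for n
  proof (induction n)
    case (Suc n)
    have "0 \<le> D * (norm (x (Suc n + T) - x (n + T)))\<^sup>2" using pos by simp
    then have "r (Suc n + T) = 0" "D * (norm (x (Suc n + T) - x (n + T)))\<^sup>2 = 0"
      using desc[of "n + T"] conjunct1[OF Suc] r(1)[of "Suc n + T"] unfolding add_Suc by linarith+
    then show ?case using Suc pos(1) by simp
  qed (simp add: T)
  then have const: "x t = x T" if "t \<ge> T" for t
    using that by (metis le_add_diff_inverse2)
  have "x \<longlonglongrightarrow> x T"
    by (rule tendsto_eventually, rule eventually_sequentiallyI[of T], rule const)
  then have "xbar = x T" using lim LIMSEQ_unique by blast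
  then have xbar: "norm (x t - xbar) = 0" if "t > Suc T" for t using const[of t] that by simp
  show ?thesis
  proof (intro conjI impI)
    show "\<exists>t0>0. x constant_on {t0<..}"
      unfolding constant_on_def
      by (intro exI[of _ "Suc T"] conjI exI[of _ "x T"] ballI const) auto
    show "\<exists>c1>0. \<exists>t1>0. \<exists>\<eta>. 0 < \<eta> \<and> \<eta> < 1 \<and> (\<forall>t>t1. norm (x t - xbar) < c1 * \<eta> ^ t)"
      by (intro exI[of _ "1 / 2 :: real"] exI[of _ "Suc T"] conjI allI impI) (simp_all add: xbar)
    show "\<exists>c2>0. \<exists>t2>0. \<forall>t>t2.
          norm (x t - xbar) < c2 * real t powr (- ((1 - \<theta>) / (2 * \<theta> - 1)))"
      by (intro exI[of _ "1 :: real"] exI[of _ "Suc T"] conjI allI impI) (simp_all add: xbar)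
  qed
next
  case False
  then have rpos: "0 < r t" for t using r(1)[of t] by (metis order_le_less)
  have "\<forall>\<^sub>F t in sequentially. r t < 1" using r(2) by (rule order_tendstoD) simp
  with kl have "\<forall>\<^sub>F t in sequentially. r t < 1 \<and>
      r (Suc t) powr \<theta> \<le> C * (norm (x (Suc (Suc t)) - x (Suc t)) + norm (x (Suc t) - x t))"
    by eventually_elim (use rpos in auto)
  then obtain T where T: "\<And>t. t \<ge> T \<Longrightarrow> r t < 1"
    "\<And>t. t \<ge> T \<Longrightarrow> r (Suc t) powr \<theta> \<le> C * (norm (x (Suc (Suc t)) - x (Suc t)) + norm (x (Suc t) - x t))"
    unfolding eventually_sequentially by blast
  let ?r = "\<lambda>t. r (t + T)" and ?x = "\<lambda>t. x (t + T)"
  have r': "0 < ?r t" "?r t \<le> 1" for t using rpos T(1)[of "t + T"] by auto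
  have desc': "?r (Suc t) + D * (norm (?x (Suc t) - ?x t))\<^sup>2 \<le> ?r t" for t
    using desc[of "t + T"] by simp
  have kl': "?r (Suc t) powr \<theta> \<le> C * (norm (?x (Suc (Suc t)) - ?x (Suc t)) + norm (?x (Suc t) - ?x t))" for t
    using T(2)[of "t + T"] by simp
  have lim': "?x \<longlonglongrightarrow> xbar" by (rule LIMSEQ_ignore_initial_segment[OF lim])
  show ?thesis
  proof (intro conjI impI)
    assume "\<theta> = 0"
    \<comment> \<open>For \<open>\<theta> = 0\<close>, KL keeps the sum of two consecutive steps at
      least \<open>1 / C\<close>, which contradicts convergence: here \<open>r\<close> must reach
      0.\<close>
    have "(\<lambda>t. C * (norm (?x (Suc (Suc t)) - ?x (Suc t)) + norm (?x (Suc t) - ?x t)))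
        \<longlonglongrightarrow> C * (norm (xbar - xbar) + norm (xbar - xbar))"
      by (intro tendsto_intros lim' LIMSEQ_Suc)
    moreover have "1 \<le> C * (norm (?x (Suc (Suc t)) - ?x (Suc t)) + norm (?x (Suc t) - ?x t))" for t
      using kl'[of t] r'(1)[of "Suc t"] \<open>\<theta> = 0\<close> by simp
    ultimately have "1 \<le> C * (norm (xbar - xbar) + norm (xbar - xbar))"
      by (intro LIMSEQ_le_const) auto
    then show "\<exists>t0>0. x constant_on {t0<..}" by simp
  next
    assume \<theta>: "0 < \<theta> \<and> \<theta> \<le> 1 / 2"
    obtain B \<eta> where B: "B > 0" "0 < \<eta>" "\<eta> < 1" "\<And>t. norm (?x (Suc t) - xbar) \<le> B * \<eta> ^ t"
      using kl_linear_rate[OF pos(1-3) conjunct2[OF \<theta>] r' desc' kl' lim'] by blast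
    \<comment> \<open>Dividing by \<open>\<eta> ^ Suc T\<close> undoes the shift; adding 1 makes the
      inequality strict.\<close>
    have "norm (x t - xbar) < (B / \<eta> ^ Suc T + 1) * \<eta> ^ t" if t: "t > Suc T" for t
    proof -
      obtain s where s: "t = Suc s + T" using t by (metis less_imp_add_positive add.commute add_Suc add_Suc_right)
      have "norm (x t - xbar) \<le> B / \<eta> ^ Suc T * \<eta> ^ t"
        using B(4)[of s] B(2) by (simp add: s power_add)
      also have "\<dots> < (B / \<eta> ^ Suc T + 1) * \<eta> ^ t"
        using B(2) by (intro mult_strict_right_mono) auto
      finally show ?thesis .
    qed
    moreover have "B / \<eta> ^ Suc T + 1 > 0" using B by (intro add_pos_pos divide_pos_pos) auto
    ultimately show "\<exists>c1>0. \<exists>t1>0. \<exists>\<eta>. 0 < \<eta> \<and> \<eta> < 1 \<and> (\<forall>t>t1. norm (x t - xbar) < c1 * \<eta> ^ t)"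
      using B(2,3) by blast
  next
    assume \<theta>: "1 / 2 < \<theta> \<and> \<theta> < 1"
    let ?e = "(1 - \<theta>) / (2 * \<theta> - 1)"
    have e: "?e > 0" using \<theta> by simp
    obtain B where B: "B > 0" "\<And>t. norm (?x (Suc t) - xbar) \<le> B * real (Suc t) powr (- ?e)"
      using kl_sublinear_rate[OF pos(1,2) conjunct1[OF \<theta>] pos(4) r' desc' kl' lim'] by blast
    have "norm (x t - xbar) < (B * real (Suc T) powr ?e + 1) * real t powr (- ?e)" if t: "t > Suc T" for t
    proof -
      obtain s where s: "t = Suc s + T" using t by (metis less_imp_add_positive add.commute add_Suc add_Suc_right)
      \<comment> \<open>This inequality shows that the shift by \<open>T\<close> costs only a
        constant factor.\<close>
      have "real t \<le> real (Suc T) * real (Suc s)"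
        unfolding of_nat_mult[symmetric] of_nat_le_iff by (simp add: s)
      then have "(real (Suc T) * real (Suc s)) powr (- ?e) \<le> real t powr (- ?e)"
        using t e by (intro powr_mono2') auto
      then have "real (Suc T) powr ?e * (real (Suc T) * real (Suc s)) powr (- ?e)
          \<le> real (Suc T) powr ?e * real t powr (- ?e)"
        by (intro mult_left_mono) auto
      moreover have "real (Suc T) powr ?e * (real (Suc T) * real (Suc s)) powr (- ?e)
          = (real (Suc T) powr ?e * real (Suc T) powr (- ?e)) * real (Suc s) powr (- ?e)"
        by (subst powr_mult) (auto simp only: mult.assoc of_nat_0_le_iff)
      moreover have "real (Suc T) powr ?e * real (Suc T) powr (- ?e) = 1"
        by (simp flip: powr_add)
      ultimately have "real (Suc s) powr (- ?e) \<le> real (Suc T) powr ?e * real t powr (- ?e)"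
        by (simp only: mult_1_left)
      then have "B * real (Suc s) powr (- ?e) \<le> B * (real (Suc T) powr ?e * real t powr (- ?e))"
        using B(1) by (intro mult_left_mono) auto
      then have "norm (x t - xbar) \<le> B * real (Suc T) powr ?e * real t powr (- ?e)"
        using B(2)[of s] by (simp add: s)
      also have "\<dots> < (B * real (Suc T) powr ?e + 1) * real t powr (- ?e)"
        using t by (intro mult_strict_right_mono) auto
      finally show ?thesis .
    qed
    moreover have "B * real (Suc T) powr ?e + 1 > 0" using B(1) by (simp add: add_nonneg_pos)
    ultimately show "\<exists>c2>0. \<exists>t2>0. \<forall>t>t2. norm (x t - xbar) < c2 * real t powr (- ?e)"
      by blast
  qed
qed

subsection \<open>Sequences generated by the algorithm\<close>

locale pdca_sequence =
  fixes f :: "'a::euclidean_space \<Rightarrow> real"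
    and gradf :: "'a \<Rightarrow> 'a"
    and P1 :: "'a \<Rightarrow> ereal"
    and P2 :: "'a \<Rightarrow> real"
    and L :: real
    and \<beta> :: "nat \<Rightarrow> real"
    and \<xi> x :: "nat \<Rightarrow> 'a"
    and xbar :: 'a
  assumes L_pos: "L > 0"
    and f_convex: "convex_on UNIV f"
    and f_grad: "\<And>z. GDERIV f z :> gradf z"
    and f_lipschitz: "L-lipschitz_on UNIV gradf"
    and P1_proper: "proper_fun P1"
    and P1_closed: "lower_semicontinuous P1"
    and P1_convex: "convex_fun P1"
    and P2_cont: "continuous_on UNIV P2"
    and P2_convex: "convex_on UNIV P2"
    and generated: "pDCAe L gradf P1 P2 \<beta> \<xi> x"
    and convergent: "x \<longlonglongrightarrow> xbar"
begin

definition y :: "nat \<Rightarrow> 'a" where "y t = x t + \<beta> t *\<^sub>R (x t - x (t - 1))"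
definition p :: "nat \<Rightarrow> real" where "p t = real_of_ereal (P1 (x t))"
text \<open>The subgradient of \<open>P1\<close> at \<open>x (Suc t)\<close> supplied by the
  optimality condition of the subproblem.\<close>

definition v :: "nat \<Rightarrow> 'a" where "v t = - (gradf (y t) - \<xi> t + L *\<^sub>R (x (Suc t) - y t))"
definition obj :: "nat \<Rightarrow> real" where "obj t = f (x t) + p t - P2 (x t)"
definition energy :: "nat \<Rightarrow> real"
  where "energy t = obj (Suc t) + L / 2 * (norm (x (Suc t) - x t))\<^sup>2"

lemma arg_min:
  "is_arg_min (\<lambda>z. ereal ((gradf (y t) - \<xi> t) \<bullet> z + L / 2 * (norm (z - y t))\<^sup>2) + P1 z)
    (\<lambda>_. True) (x (Suc t))"
  using generated by (simp add: pDCAe_def y_def Let_def)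

lemma P1_x: "P1 (x t) = ereal (p t)"
proof -
  have "x t \<in> edom P1"
  proof (cases t)
    case 0
    then show ?thesis using generated by (simp add: pDCAe_def)
  next
    case (Suc s)
    then show ?thesis using prox_optimality(1)[OF P1_proper P1_convex arg_min] by simp
  qed
  moreover have "P1 (x t) \<noteq> -\<infinity>" using P1_proper by (simp add: proper_fun_def)
  ultimately show ?thesis unfolding p_def edom_def by (cases "P1 (x t)") auto
qed

lemma P1_subgradient: "ereal (p (Suc t) + v t \<bullet> (u - x (Suc t))) \<le> P1 u"
  using prox_optimality(2)[OF P1_proper P1_convex arg_min, of t u] P1_x[of "Suc t"]
  by (simp add: v_def)

lemma P2_subgradient: "P2 (x t) + \<xi> t \<bullet> (u - x t) \<le> P2 u"
  using generated by (intro subdifferential_convex[OF P2_convex]) (simp add: pDCAe_def)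

lemma beta_bounds: "0 \<le> \<beta> t" "\<beta> t < 1" "\<beta> t \<le> (SUP t. \<beta> t)"
proof -
  have "bdd_above (range \<beta>)"
    using generated by (intro bdd_aboveI[of _ 1]) (auto simp: pDCAe_def less_imp_le)
  then show "\<beta> t \<le> (SUP t. \<beta> t)" by (rule cSUP_upper2) auto
qed (use generated in \<open>auto simp: pDCAe_def\<close>)

lemma Sup_beta_less_1: "(SUP t. \<beta> t) < 1"
  using generated by (simp add: pDCAe_def)

section \<open>Energy descent\<close>

text \<open>The sum of four inequalities: the subgradient inequalities of \<open>P1\<close> and
  \<open>P2\<close>, and the upper and lower bounds for \<open>f\<close> around
  \<open>y t\<close>.\<close>

lemma obj_descent:
  "obj (Suc t) + L / 2 * (norm (x (Suc t) - x t))\<^sup>2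
    \<le> obj t + L / 2 * (\<beta> t)\<^sup>2 * (norm (x t - x (t - 1)))\<^sup>2"
proof -
  let ?x = "x t" and ?x' = "x (Suc t)" and ?y = "y t"
  have 1: "p (Suc t) + v t \<bullet> (?x - ?x') \<le> p t"
    using P1_subgradient[of t ?x] P1_x[of t] by simp
  have 2: "f ?x' \<le> f ?y + gradf ?y \<bullet> (?x' - ?y) + L / 2 * (norm (?x' - ?y))\<^sup>2"
    by (rule lipschitz_gradient_upper_bound[OF f_grad f_lipschitz])
  have 3: "f ?y + gradf ?y \<bullet> (?x - ?y) \<le> f ?x"
    by (rule convex_gradient_ineq[OF f_convex f_grad])
  have 4: "P2 ?x + \<xi> t \<bullet> (?x' - ?x) \<le> P2 ?x'" by (rule P2_subgradient)
  \<comment> \<open>The squared norms come from the three-point identity for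
    \<open>(?x' - ?y) \<bullet> (?x' - ?x)\<close>.\<close>
  have 5: "v t \<bullet> (?x - ?x') = gradf ?y \<bullet> (?x' - ?y) - gradf ?y \<bullet> (?x - ?y) - \<xi> t \<bullet> (?x' - ?x)
      + L / 2 * (norm (?x' - ?y))\<^sup>2 + L / 2 * (norm (?x' - ?x))\<^sup>2 - L / 2 * (norm (?x - ?y))\<^sup>2"
    unfolding power2_norm_eq_inner v_def
    by (simp add: inner_add_left inner_diff_left inner_diff_right inner_commute algebra_simps)
  have 6: "(norm (?x - ?y))\<^sup>2 = (\<beta> t)\<^sup>2 * (norm (x t - x (t - 1)))\<^sup>2"
    by (simp add: y_def power_mult_distrib)
  show ?thesis using 1 2 3 4 unfolding 5 6 obj_def by (simp add: mult.assoc)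
qed

text \<open>At \<open>Suc t\<close> the extrapolation term carries the same squared distance as
  \<open>energy t\<close>, with weight reduced by \<open>(\<beta> (Suc t))\<^sup>2\<close>; the
  difference is the gain.\<close>

lemma energy_descent:
  "energy (Suc t) + L / 2 * (1 - (SUP t. \<beta> t)\<^sup>2) * (norm (x (Suc t) - x t))\<^sup>2 \<le> energy t"
proof -
  have "(\<beta> (Suc t))\<^sup>2 \<le> (SUP t. \<beta> t)\<^sup>2" using beta_bounds[of "Suc t"] by (intro power_mono) auto
  then have "L / 2 * (\<beta> (Suc t))\<^sup>2 * (norm (x (Suc t) - x t))\<^sup>2
      \<le> L / 2 * (SUP t. \<beta> t)\<^sup>2 * (norm (x (Suc t) - x t))\<^sup>2"
    using L_pos by (intro mult_right_mono mult_left_mono) auto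
  then show ?thesis using obj_descent[of "Suc t"] by (simp add: energy_def algebra_simps)
qed

lemma descent_constant_pos: "0 < L / 2 * (1 - (SUP t. \<beta> t)\<^sup>2)"
proof -
  have "(SUP t. \<beta> t)\<^sup>2 < 1\<^sup>2"
    using beta_bounds[of 0] Sup_beta_less_1 by (intro power_strict_mono) auto
  then show ?thesis using L_pos by simp
qed

lemma energy_antimono: "energy (Suc t) \<le> energy t"
  using energy_descent[of t] mult_nonneg_nonneg[OF less_imp_le[OF descent_constant_pos] zero_le_power2[of "norm (x (Suc t) - x t)"]]
  by linarith

section \<open>Limits along the iterates\<close>

lemma x_prev_lim: "(\<lambda>t. x (t - 1)) \<longlonglongrightarrow> xbar"
  by (rule LIMSEQ_imp_Suc) (simp add: convergent)

lemma y_lim: "y \<longlonglongrightarrow> xbar"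
proof -
  have "(\<lambda>t. \<beta> t *\<^sub>R (x t - x (t - 1))) \<longlonglongrightarrow> 0"
  proof (rule Lim_null_comparison)
    show "\<forall>\<^sub>F t in sequentially. norm (\<beta> t *\<^sub>R (x t - x (t - 1))) \<le> norm (x t - x (t - 1))"
      using beta_bounds(1,2) by (intro always_eventually allI) (simp add: mult_left_le_one_le less_imp_le)
    show "(\<lambda>t. norm (x t - x (t - 1))) \<longlonglongrightarrow> 0"
      using tendsto_norm[OF tendsto_diff[OF convergent x_prev_lim]] by simp
  qed
  from tendsto_add[OF convergent this] show ?thesis by (simp add: y_def[abs_def])
qed

lemma gradf_y_lim: "(\<lambda>t. gradf (y t)) \<longlonglongrightarrow> gradf xbar"
  using lipschitz_on_continuous_on[OF f_lipschitz] y_lim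
  by (auto intro: continuous_on_tendsto_compose)

lemma P2_x_lim: "(\<lambda>t. P2 (x t)) \<longlonglongrightarrow> P2 xbar"
  using P2_cont convergent by (auto intro: continuous_on_tendsto_compose)

lemma f_x_lim: "(\<lambda>t. f (x t)) \<longlonglongrightarrow> f xbar"
  by (rule isCont_tendsto_compose[OF has_derivative_continuous[OF gderiv_inner[THEN iffD1, OF f_grad]] convergent])

lemma xi_bounded: "bounded (range \<xi>)"
  using convergent_imp_bounded[OF convergent]
  by (intro subgradients_bounded[OF P2_cont _ P2_subgradient])

text \<open>Decreasing energy bounds \<open>P1\<close> along the iterates, whereas an infinite limit
  value would by lower semicontinuity push it above every bound.\<close>

lemma P1_xbar_finite: "P1 xbar < \<infinity>"
proof (rule ccontr)
  \<comment> \<open>The 1 is slack: \<open>f - P2\<close> eventually exceeds its limit minus 1, so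
    \<open>P1\<close> above \<open>?C\<close> would lift the objective above
    \<open>energy 0\<close>.\<close>
  let ?C = "energy 0 - (f xbar - P2 xbar - 1)"
  assume "\<not> ?thesis"
  then have "\<forall>\<^sub>F t in sequentially. ereal ?C < P1 (x (Suc t))"
    by (intro lower_semicontinuous_eventually[OF P1_closed, of _ xbar] LIMSEQ_Suc[OF convergent]) simp
  moreover have "\<forall>\<^sub>F t in sequentially. f xbar - P2 xbar - 1 < f (x (Suc t)) - P2 (x (Suc t))"
    by (rule order_tendstoD[OF tendsto_diff[OF LIMSEQ_Suc[OF f_x_lim] LIMSEQ_Suc[OF P2_x_lim]]]) simp
  ultimately have "\<forall>\<^sub>F t::nat in sequentially. False"
  proof eventually_elim
    case (elim t)
    have "energy t \<le> energy 0" 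
      using lift_Suc_antimono_le[of energy, OF energy_antimono] by simp
    moreover have "obj (Suc t) \<le> energy t" using L_pos by (simp add: energy_def)
    ultimately show False using elim P1_x[of "Suc t"] by (simp add: obj_def)
  qed
  then show False by simp
qed

definition pbar :: real where "pbar = real_of_ereal (P1 xbar)"

lemma P1_xbar: "P1 xbar = ereal pbar"
  using P1_xbar_finite P1_proper unfolding pbar_def proper_fun_def by (cases "P1 xbar") auto

text \<open>The lower half is lower semicontinuity. The upper half tests the subgradient
  \<open>v t\<close> at \<open>xbar\<close>, where the linear term vanishes in the limit.\<close>

lemma p_lim: "p \<longlonglongrightarrow> pbar"
proof (rule order_tendstoI)
  fix a assume "a < pbar"
  then have "\<forall>\<^sub>F t in sequentially. ereal a < P1 (x t)"
    by (intro lower_semicontinuous_eventually[OF P1_closed convergent]) (simp add: P1_xbar)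
  then show "\<forall>\<^sub>F t in sequentially. a < p t" by (simp add: P1_x)
next
  fix a assume a: "pbar < a"
  obtain B where B: "\<And>t. norm (\<xi> t) \<le> B" using xi_bounded by (auto simp: bounded_iff)
  have dlim: "(\<lambda>t. xbar - x (Suc t)) \<longlonglongrightarrow> 0"
    using tendsto_diff[OF tendsto_const LIMSEQ_Suc[OF convergent], of xbar] by simp
  \<comment> \<open>\<open>\<xi>\<close> is only known to be bounded, so its share of
    \<open>v\<close> is treated apart from the convergent rest.\<close>
  have "(\<lambda>t. \<xi> t \<bullet> (xbar - x (Suc t))) \<longlonglongrightarrow> 0"
  proof (rule Lim_null_comparison)
    show "\<forall>\<^sub>F t in sequentially. norm (\<xi> t \<bullet> (xbar - x (Suc t))) \<le> B * norm (xbar - x (Suc t))"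
      using B by (intro always_eventually allI)
        (simp, meson Cauchy_Schwarz_ineq2 mult_right_mono norm_ge_zero order_trans)
    show "(\<lambda>t. B * norm (xbar - x (Suc t))) \<longlonglongrightarrow> 0"
      using tendsto_mult_left[OF tendsto_norm[OF dlim], of B] by simp
  qed
  moreover have "(\<lambda>t. (gradf (y t) + L *\<^sub>R (x (Suc t) - y t)) \<bullet> (xbar - x (Suc t)))
      \<longlonglongrightarrow> (gradf xbar + L *\<^sub>R (xbar - xbar)) \<bullet> 0"
    by (intro tendsto_intros gradf_y_lim y_lim LIMSEQ_Suc[OF convergent] dlim)
  ultimately have "(\<lambda>t. pbar + (gradf (y t) + L *\<^sub>R (x (Suc t) - y t)) \<bullet> (xbar - x (Suc t))
      - \<xi> t \<bullet> (xbar - x (Suc t))) \<longlonglongrightarrow> pbar + 0 - 0"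
    by (intro tendsto_intros) simp_all
  then have "(\<lambda>t. pbar - v t \<bullet> (xbar - x (Suc t))) \<longlonglongrightarrow> pbar"
    by (simp add: v_def inner_add_left inner_diff_left algebra_simps)
  then have "\<forall>\<^sub>F t in sequentially. pbar - v t \<bullet> (xbar - x (Suc t)) < a"
    using a by (rule order_tendstoD)
  then have "\<forall>\<^sub>F t in sequentially. p (Suc t) < a"
  proof eventually_elim
    case (elim t)
    then show ?case using P1_subgradient[of t xbar] by (simp add: P1_xbar)
  qed
  then show "\<forall>\<^sub>F t in sequentially. p t < a" by (rule eventually_sequentially_Suc[THEN iffD1])
qed

definition obj_bar :: real where "obj_bar = f xbar + pbar - P2 xbar"

lemma energy_lim: "energy \<longlonglongrightarrow> obj_bar"
proof -
  have "(\<lambda>t. obj (Suc t) + L / 2 * (norm (x (Suc t) - x t))\<^sup>2)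
      \<longlonglongrightarrow> f xbar + pbar - P2 xbar + L / 2 * (norm (xbar - xbar))\<^sup>2"
    unfolding obj_def
    by (intro tendsto_intros LIMSEQ_Suc convergent) (intro LIMSEQ_Suc f_x_lim p_lim P2_x_lim)+
  then show ?thesis by (simp add: energy_def[abs_def] obj_bar_def)
qed

lemma energy_ge: "obj_bar \<le> energy t"
  using decseq_ge[OF _ energy_lim] decseq_SucI[of energy, OF energy_antimono] by blast

text \<open>Along a subsequence on which \<open>\<xi>\<close> converges, \<open>v\<close> converges
  too, and both subgradient inequalities pass to the limit.\<close>

lemma limit_subgradients:
  obtains w vbar where "gradf xbar + vbar - w = 0"
    "\<And>u. P1 xbar + ereal (vbar \<bullet> (u - xbar)) \<le> P1 u" "\<And>u. P2 xbar + w \<bullet> (u - xbar) \<le> P2 u"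
proof -
  obtain w \<sigma> where \<sigma>: "strict_mono \<sigma>" "(\<lambda>t. \<xi> (\<sigma> t)) \<longlonglongrightarrow> w"
    using bounded_imp_convergent_subsequence[OF xi_bounded] by (auto simp: comp_def)
  note sub = LIMSEQ_subseq_LIMSEQ[OF _ \<sigma>(1), unfolded comp_def]
  note xs = sub[OF LIMSEQ_Suc[OF convergent]]
  define vbar where "vbar = - (gradf xbar - w + L *\<^sub>R (xbar - xbar))"
  have vlim: "(\<lambda>t. v (\<sigma> t)) \<longlonglongrightarrow> vbar"
    unfolding v_def vbar_def by (intro tendsto_intros \<sigma>(2) xs sub[OF gradf_y_lim] sub[OF y_lim])
  have "P1 xbar + ereal (vbar \<bullet> (u - xbar)) \<le> P1 u" for u
  proof -
    have "(\<lambda>t. ereal (p (Suc (\<sigma> t)) + v (\<sigma> t) \<bullet> (u - x (Suc (\<sigma> t)))))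
        \<longlonglongrightarrow> ereal (pbar + vbar \<bullet> (u - xbar))"
      by (intro tendsto_intros vlim xs sub[OF LIMSEQ_Suc[OF p_lim]])
    then have "ereal (pbar + vbar \<bullet> (u - xbar)) \<le> P1 u"
      by (rule LIMSEQ_le_const2) (use P1_subgradient in blast)
    then show ?thesis by (simp add: P1_xbar)
  qed
  moreover have "P2 xbar + w \<bullet> (u - xbar) \<le> P2 u" for u
  proof (rule LIMSEQ_le_const2)
    show "(\<lambda>t. P2 (x (\<sigma> t)) + \<xi> (\<sigma> t) \<bullet> (u - x (\<sigma> t))) \<longlonglongrightarrow> P2 xbar + w \<bullet> (u - xbar)"
      by (intro tendsto_intros \<sigma>(2) sub[OF P2_x_lim] sub[OF convergent])
  qed (use P2_subgradient in blast)
  ultimately show ?thesis using that[of vbar w] by (simp add: vbar_def)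
qed

lemma xbar_stationary: "xbar \<in> stationary_points gradf P1 P2"
proof -
  obtain w vbar where *: "gradf xbar + vbar - w = 0"
    "\<And>u. P1 xbar + ereal (vbar \<bullet> (u - xbar)) \<le> P1 u" "\<And>u. P2 xbar + w \<bullet> (u - xbar) \<le> P2 u"
    using limit_subgradients by metis
  have "vbar \<in> subdifferential P1 xbar"
    by (rule subgradient_in_subdifferential[OF *(2) P1_xbar])
  moreover have "w \<in> subdifferential (\<lambda>z. ereal (P2 z)) xbar"
    by (rule subgradient_in_subdifferential) (use *(3) in auto)
  ultimately show ?thesis unfolding stationary_points_def
    using *(1)[symmetric] by blast
qed

section \<open>The auxiliary function along the iterates\<close>

lemma auxiliary_fun_iterates: "auxiliary_fun L f P1 P2 (x (Suc t), x t) = ereal (energy t)"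
  by (simp add: auxiliary_fun_def dc_objective_def P1_x energy_def obj_def)

lemma auxiliary_fun_limit: "auxiliary_fun L f P1 P2 (xbar, xbar) = ereal obj_bar"
  by (simp add: auxiliary_fun_def dc_objective_def P1_xbar obj_bar_def)

text \<open>KL is assumed only where the subdifferential is nonempty, so a subgradient at the limit
  pair has to be exhibited.\<close>

lemma limit_in_dom_subdifferential:
  assumes "GDERIV P2 xbar :> g"
  shows "(xbar, xbar) \<in> dom_subdifferential (auxiliary_fun L f P1 P2)"
proof -
  obtain vbar where "\<And>u. P1 xbar + ereal (vbar \<bullet> (u - xbar)) \<le> P1 u"
    using limit_subgradients by metis
  from auxiliary_fun_subgradient[where ?P1.0 = P1 and x = xbar, OF P1_xbar this f_grad assms]
  show ?thesis unfolding dom_subdifferential_def by blast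
qed

text \<open>Once \<open>\<xi> t = g\<close> is substituted into \<open>v t\<close>, the explicit
  subgradient consists of differences only, each controlled by the last two steps.\<close>

lemma edist_subdifferential_iterates:
  assumes grad: "GDERIV P2 (x t) :> g" "GDERIV P2 (x (Suc t)) :> g'"
    and K: "norm (g' - g) \<le> K * norm (x (Suc t) - x t)" "0 \<le> K"
  shows "edist_set 0 (subdifferential (auxiliary_fun L f P1 P2) (x (Suc t), x t))
    \<le> ereal ((4 * L + K) * (norm (x (Suc t) - x t) + norm (x t - x (t - 1))))"
proof -
  let ?x = "x t" and ?x' = "x (Suc t)" and ?y = "y t"
  let ?s = "(gradf ?x' + v t - g' + L *\<^sub>R (?x' - ?x), - (L *\<^sub>R (?x' - ?x)))"
  have xi: "\<xi> t = g" by (rule subgradient_eq_gradient[OF P2_subgradient grad(1)])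
  have "?s \<in> subdifferential (auxiliary_fun L f P1 P2) (?x', ?x)"
    using P1_subgradient[of t] P1_x[of "Suc t"]
    by (intro auxiliary_fun_subgradient[where ?P1.0 = P1 and x = "x (Suc t)", OF P1_x _ f_grad grad(2)]) simp
  then have "edist_set 0 (subdifferential (auxiliary_fun L f P1 P2) (?x', ?x)) \<le> ereal (norm (0 - ?s))"
    unfolding edist_set_def by (rule INF_lower)
  also have "norm (0 - ?s) \<le> (4 * L + K) * (norm (?x' - ?x) + norm (?x - x (t - 1)))"
  proof -
    let ?d = "norm (?x' - ?x)" and ?e = "norm (?x - x (t - 1))"
    have "?x' - ?y = (?x' - ?x) - \<beta> t *\<^sub>R (?x - x (t - 1))" by (simp add: y_def)
    then have "norm (?x' - ?y) \<le> ?d + norm (\<beta> t *\<^sub>R (?x - x (t - 1)))"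
      by (metis norm_triangle_ineq4)
    also have "norm (\<beta> t *\<^sub>R (?x - x (t - 1))) \<le> ?e"
      using beta_bounds(1,2)[of t] by (simp add: mult_left_le_one_le less_imp_le)
    finally have xy: "norm (?x' - ?y) \<le> ?d + ?e" by simp
    have lip: "norm (gradf ?x' - gradf ?y) \<le> L * norm (?x' - ?y)"
      using lipschitz_onD[OF f_lipschitz, of ?x' ?y] by (simp add: dist_norm)
    have "fst ?s = (gradf ?x' - gradf ?y) - (g' - g) - L *\<^sub>R (?x' - ?y) + L *\<^sub>R (?x' - ?x)"
      by (simp add: v_def xi)
    moreover have "norm (a - b - c + e) \<le> norm a + norm b + norm c + norm e" for a b c e :: 'a
      using norm_triangle_ineq[of "a - b - c" e] norm_triangle_ineq4[of "a - b" c]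
        norm_triangle_ineq4[of a b] by linarith
    ultimately have "norm (fst ?s) \<le> norm (gradf ?x' - gradf ?y) + norm (g' - g)
        + norm (L *\<^sub>R (?x' - ?y)) + norm (L *\<^sub>R (?x' - ?x))"
      by metis
    also have "\<dots> \<le> 2 * (L * norm (?x' - ?y)) + K * ?d + L * ?d"
      using lip K L_pos by simp
    also have "\<dots> \<le> 2 * (L * (?d + ?e)) + K * ?d + L * ?d"
      using xy L_pos by simp
    \<comment> \<open>\<open>4 * L\<close> will collect \<open>2 * L\<close> from
      \<open>?x' - ?y\<close> and one \<open>L\<close> per component from
      \<open>?x' - ?x\<close>.\<close>
    finally have "norm (fst ?s) + norm (snd ?s) \<le> 2 * (L * (?d + ?e)) + K * ?d + 2 * (L * ?d)"
      using L_pos by simp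
    also have "\<dots> \<le> (4 * L + K) * (?d + ?e)"
      using L_pos K(2) by (simp add: algebra_simps)
    finally show ?thesis
      using norm_Pair_le[of "fst ?s" "snd ?s"] unfolding diff_0 norm_minus_cancel by simp
  qed
  finally show ?thesis by simp
qed

end

section \<open>The KL inequality at the iterates and the conclusion\<close>

theorem theorem4p3:
  fixes f :: "real ^ 'n \<Rightarrow> real"
    and gradf :: "real ^ 'n \<Rightarrow> real ^ 'n"
    and P1 :: "real ^ 'n \<Rightarrow> ereal"
    and P2 :: "real ^ 'n \<Rightarrow> real"
    and gradP2 :: "real ^ 'n \<Rightarrow> real ^ 'n"
    and L c \<theta> :: real
    and N0 :: "(real ^ 'n) set"
    and \<beta> :: "nat \<Rightarrow> real"
    and \<xi> x :: "nat \<Rightarrow> real ^ 'n"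
    and xbar :: "real ^ 'n"
  assumes L_pos: "L > 0"
    and f_convex: "convex_on UNIV f"
    and f_grad: "\<And>z. GDERIV f z :> gradf z"
    and f_lipschitz: "L-lipschitz_on UNIV gradf"
    and P1_proper: "proper_fun P1"
    and P1_closed: "lower_semicontinuous P1"
    and P1_convex: "convex_fun P1"
    and P2_cont: "continuous_on UNIV P2"
    and P2_convex: "convex_on UNIV P2"
    and F_level_bounded: "level_bounded (dc_objective f P1 P2)"
    and N0_open: "open N0"
    and N0_stationary: "stationary_points gradf P1 P2 \<subseteq> N0"
    and P2_grad: "\<And>z. z \<in> N0 \<Longrightarrow> GDERIV P2 z :> gradP2 z"
    and P2_C1: "continuous_on N0 gradP2"
    and P2_loc_lipschitz: "locally_lipschitz_on N0 gradP2"
    and generated: "pDCAe L gradf P1 P2 \<beta> \<xi> x"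
    and convergent: "x \<longlonglongrightarrow> xbar"
    and \<theta>_range: "0 \<le> \<theta>" "\<theta> < 1"
    and c_pos: "c > 0"
    and E_KL: "KL_function_with (\<lambda>s. c * s powr (1 - \<theta>)) (auxiliary_fun L f P1 P2)"
  shows "(\<theta> = 0 \<longrightarrow> (\<exists>t0>0. x constant_on {t0<..})) \<and>
    (0 < \<theta> \<and> \<theta> \<le> 1 / 2 \<longrightarrow>
       (\<exists>c1>0. \<exists>t1>0. \<exists>\<eta>. 0 < \<eta> \<and> \<eta> < 1 \<and>
          (\<forall>t>t1. norm (x t - xbar) < c1 * \<eta> ^ t))) \<and>
    (1 / 2 < \<theta> \<and> \<theta> < 1 \<longrightarrow>
       (\<exists>c2>0. \<exists>t2>0. \<forall>t>t2.
          norm (x t - xbar) < c2 * real t powr (- ((1 - \<theta>) / (2 * \<theta> - 1)))))"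
proof -
  interpret pdca_sequence f gradf P1 P2 L \<beta> \<xi> x xbar
    by unfold_locales (fact L_pos f_convex f_grad f_lipschitz P1_proper P1_closed P1_convex
        P2_cont P2_convex generated convergent)+
  have xbar_N0: "xbar \<in> N0" using xbar_stationary N0_stationary by blast
  obtain \<rho> K where \<rho>: "\<rho> > 0" and lip: "K-lipschitz_on (ball xbar \<rho> \<inter> N0) gradP2"
    using P2_loc_lipschitz xbar_N0 unfolding locally_lipschitz_on_def by blast
  have K: "0 \<le> K" using lip by (rule lipschitz_on_nonneg)
  let ?E = "auxiliary_fun L f P1 P2" and ?\<phi> = "\<lambda>s. c * s powr (1 - \<theta>)"
  define r where "r t = energy t - obj_bar" for t
  have r_lim: "r \<longlonglongrightarrow> 0"
    unfolding r_def using tendsto_diff[OF energy_lim tendsto_const, of obj_bar] by simp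
  have "KL_property_with ?\<phi> ?E (xbar, xbar)"
    using E_KL limit_in_dom_subdifferential[OF P2_grad[OF xbar_N0]]
    unfolding KL_function_with_def by blast
  then obtain a U where a: "0 < a" and U: "open U" "(xbar, xbar) \<in> U"
    and KL: "\<And>z. z \<in> U \<Longrightarrow> ?E (xbar, xbar) < ?E z \<Longrightarrow> ?E z < ?E (xbar, xbar) + a \<Longrightarrow>
      1 \<le> ereal (deriv ?\<phi> (real_of_ereal (?E z - ?E (xbar, xbar)))) * edist_set 0 (subdifferential ?E z)"
    unfolding KL_property_with_def by blast
  \<comment> \<open>\<open>c * (1 - \<theta>)\<close> comes from the derivative of
    \<open>?\<phi>\<close>, \<open>4 * L + K\<close> from the distance bound.\<close>
  define C where "C = c * (1 - \<theta>) * (4 * L + K)"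
  have C: "C > 0" using c_pos \<theta>_range L_pos K by (simp add: C_def)
  \<comment> \<open>KL is used at the pair whose value is \<open>energy (Suc t)\<close>, hence the
    shifts by one and two.\<close>
  have ev_U: "\<forall>\<^sub>F t in sequentially. (x (Suc (Suc t)), x (Suc t)) \<in> U"
    using tendsto_Pair[OF LIMSEQ_Suc[OF LIMSEQ_Suc[OF convergent]] LIMSEQ_Suc[OF convergent]] U
    by (rule topological_tendstoD)
  have ev_a: "\<forall>\<^sub>F t in sequentially. ereal (r (Suc t)) < a"
    by (rule order_tendstoD(2)[OF tendsto_ereal[OF LIMSEQ_Suc[OF r_lim]]]) (use a in \<open>simp add: zero_ereal_def\<close>)
  have "\<forall>\<^sub>F t in sequentially. x t \<in> ball xbar \<rho> \<inter> N0"
    using convergent by (rule topological_tendstoD) (use \<rho> N0_open xbar_N0 in auto)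
  then have ev_N1: "\<forall>\<^sub>F t in sequentially. x (Suc t) \<in> ball xbar \<rho> \<inter> N0"
    by (rule eventually_sequentially_Suc[THEN iffD2])
  then have ev_N2: "\<forall>\<^sub>F t in sequentially. x (Suc (Suc t)) \<in> ball xbar \<rho> \<inter> N0"
    by (rule eventually_sequentially_Suc[THEN iffD2])
  have kl: "\<forall>\<^sub>F t in sequentially. 0 < r (Suc t) \<longrightarrow>
      r (Suc t) powr \<theta> \<le> C * (norm (x (Suc (Suc t)) - x (Suc t)) + norm (x (Suc t) - x t))"
    using ev_U ev_a ev_N1 ev_N2
  proof eventually_elim
    case (elim t)
    show ?case
    proof
      assume r: "0 < r (Suc t)"
      let ?z = "(x (Suc (Suc t)), x (Suc t))" and ?s = "r (Suc t)"
      let ?d = "norm (x (Suc (Suc t)) - x (Suc t)) + norm (x (Suc t) - x t)"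
      have E: "?E ?z = ereal (energy (Suc t))" by (rule auxiliary_fun_iterates)
      have above: "?E (xbar, xbar) < ?E ?z" using r by (simp add: E auxiliary_fun_limit r_def)
      have below: "?E ?z < ?E (xbar, xbar) + a"
        using elim(2) by (cases a) (auto simp: E auxiliary_fun_limit r_def)
      have "(?\<phi> has_real_derivative c * ((1 - \<theta>) * ?s powr (- \<theta>))) (at ?s)"
        using r by (auto intro!: derivative_eq_intros)
      then have deriv: "deriv ?\<phi> ?s = c * (1 - \<theta>) * ?s powr (- \<theta>)"
        by (simp add: DERIV_imp_deriv mult.assoc)
      have "norm (gradP2 (x (Suc (Suc t))) - gradP2 (x (Suc t))) \<le> K * norm (x (Suc (Suc t)) - x (Suc t))"
        using lipschitz_onD[OF lip elim(4,3)] by (simp add: dist_norm)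
      \<comment> \<open>At index \<open>Suc t\<close> the truncated predecessor is truly
        \<open>x t\<close>.\<close>
      then have dist: "edist_set 0 (subdifferential ?E ?z) \<le> ereal ((4 * L + K) * ?d)"
        using edist_subdifferential_iterates[OF P2_grad P2_grad _ K, of "Suc t"] elim by simp
      have "1 \<le> ereal (deriv ?\<phi> (real_of_ereal (?E ?z - ?E (xbar, xbar)))) * edist_set 0 (subdifferential ?E ?z)"
        by (rule KL[OF elim(1) above below])
      also have "real_of_ereal (?E ?z - ?E (xbar, xbar)) = ?s"
        by (simp add: E auxiliary_fun_limit r_def)
      also have "ereal (deriv ?\<phi> ?s) * edist_set 0 (subdifferential ?E ?z)
          \<le> ereal (deriv ?\<phi> ?s) * ereal ((4 * L + K) * ?d)"
        using dist c_pos \<theta>_range by (intro ereal_mult_left_mono) (simp_all add: deriv)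
      also have "\<dots> = ereal (C * ?d * ?s powr (- \<theta>))"
        by (simp add: deriv C_def mult_ac)
      finally have "1 \<le> C * ?d * ?s powr (- \<theta>)" by (simp add: one_ereal_def)
      \<comment> \<open>Multiplying by \<open>?s powr \<theta>\<close> moves the derivative's
        negative power to the other side.\<close>
      then have "?s powr \<theta> * 1 \<le> ?s powr \<theta> * (C * ?d * ?s powr (- \<theta>))"
        by (intro mult_left_mono) auto
      also have "\<dots> = C * ?d * (?s powr \<theta> * ?s powr (- \<theta>))" by (simp only: mult_ac)
      also have "?s powr \<theta> * ?s powr (- \<theta>) = 1" using r by (simp flip: powr_add)
      finally show "?s powr \<theta> \<le> C * ?d" by simp
    qed
  qed
  let ?D = "L / 2 * (1 - (SUP t. \<beta> t)\<^sup>2)"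
  have "r (Suc t) + ?D * (norm (x (Suc t) - x t))\<^sup>2 \<le> r t" "0 \<le> r t" for t
    using energy_descent[of t] energy_ge[of t] by (auto simp: r_def)
  then show ?thesis
    by (intro kl_convergence_rates[of ?D C \<theta> r x xbar] descent_constant_pos C \<theta>_range r_lim kl convergent)
qed

end
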